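(* There exists a non-collapsing generalized Ricci flow $(M^n,g(t),H(t))$, $t\in[0,T)$, which does not admit any torsion-bounding function.
   Context: A generalized Ricci flow on $M$ is a family of Riemannian metrics $g(t)$ and closed $3$-forms $H(t)$ with $\partial_tg=-2\operatorname{Ric}+\frac12H^2$, $\partial_tH=-\Delta_dH$, where $(H^2)_{ij}=g^{pq}g^{kl}H_{ipk}H_{jql}$ and $\Delta_d=dd^*+d^*d$. A torsion-bounding function for the flow is a smooth function $\psi\ge0$ on $M\times[0,T)$ with $(\partial_t-\Delta_{g(t)})\psi\le-|H|^2$, where $|H|^2=g^{ij}(H^2)_{ij}$. Here $T\in(0,\infty)$, and non-collapsing is meant in Perelman's sense: there is $\kappa>0$ such that for all $x\in M$, $t\in[0,T)$ and $0<r\le\sqrt T$, if $|\mathrm{Rm}_{g(t)}|\le r^{-2}$ on the ball $B_{g(t)}(x,r)$, then $\operatorname{Vol}_{g(t)}B_{g(t)}(x,r)\ge\kappa r^n$. *)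

theory Defs
  imports "HOL-Analysis.Analysis" "Jordan_Normal_Form.Determinant"
begin

section \<open>Smooth functions on open subsets of $R^n$\<close>

text \<open>
  Since the dimension \<open>n\<close> is existentially quantified in the theorem, it cannot be a type.
  Points of $R^n$ are the points of the library space \<^const>\<open>Euclidean_space\<close> \<open>n\<close>, i.e.
  functions \<open>nat \<Rightarrow> real\<close> vanishing at all indices \<open>i \<ge> n\<close>; tensor and coordinate indices
  run over \<open>0, \<dots>, n - 1\<close>.
\<close>

definition coord_partial :: "nat \<Rightarrow> ((nat \<Rightarrow> real) \<Rightarrow> real) \<Rightarrow> (nat \<Rightarrow> real) \<Rightarrow> real" where
  "coord_partial i F x = deriv (\<lambda>s. F (x(i := s))) (x i)"

fun Ck_on :: "nat \<Rightarrow> (nat \<Rightarrow> real) set \<Rightarrow> nat \<Rightarrow> ((nat \<Rightarrow> real) \<Rightarrow> real) \<Rightarrow> bool" where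
  "Ck_on n V 0 F \<longleftrightarrow> continuous_map (subtopology (Euclidean_space n) V) euclideanreal F"
| "Ck_on n V (Suc k) F \<longleftrightarrow>
     continuous_map (subtopology (Euclidean_space n) V) euclideanreal F \<and>
     (\<forall>i<n. (\<forall>x\<in>V. (\<lambda>s. F (x(i := s))) field_differentiable (at (x i))) \<and>
            Ck_on n V k (coord_partial i F))"

definition smooth_on_open :: "nat \<Rightarrow> (nat \<Rightarrow> real) set \<Rightarrow> ((nat \<Rightarrow> real) \<Rightarrow> real) \<Rightarrow> bool" where
  "smooth_on_open n V F \<longleftrightarrow> (\<forall>k. Ck_on n V k F)"

text \<open>
  Time-dependent functions on \<open>J \<times> V\<close> with \<open>J\<close> a real interval, possibly containing an end
  point; there the time derivative is one-sided. All iterated derivatives in space and time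
  are required to exist and to be jointly continuous.
\<close>

definition time_deriv ::
  "real set \<Rightarrow> (real \<Rightarrow> (nat \<Rightarrow> real) \<Rightarrow> real) \<Rightarrow> real \<Rightarrow> (nat \<Rightarrow> real) \<Rightarrow> real" where
  "time_deriv J F t x = vector_derivative (\<lambda>s. F s x) (at t within J)"

fun Ck_spacetime_on ::
  "nat \<Rightarrow> real set \<Rightarrow> (nat \<Rightarrow> real) set \<Rightarrow> nat \<Rightarrow> (real \<Rightarrow> (nat \<Rightarrow> real) \<Rightarrow> real) \<Rightarrow> bool" where
  "Ck_spacetime_on n J V 0 F \<longleftrightarrow>
     continuous_map (prod_topology (top_of_set J) (subtopology (Euclidean_space n) V))
       euclideanreal (\<lambda>(t, x). F t x)"
| "Ck_spacetime_on n J V (Suc k) F \<longleftrightarrow>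
     continuous_map (prod_topology (top_of_set J) (subtopology (Euclidean_space n) V))
       euclideanreal (\<lambda>(t, x). F t x) \<and>
     (\<forall>t\<in>J. \<forall>x\<in>V. (\<lambda>s. F s x) differentiable (at t within J)) \<and>
     Ck_spacetime_on n J V k (time_deriv J F) \<and>
     (\<forall>i<n. (\<forall>t\<in>J. \<forall>x\<in>V. (\<lambda>s. F t (x(i := s))) field_differentiable (at (x i))) \<and>
            Ck_spacetime_on n J V k (\<lambda>t. coord_partial i (F t)))"

definition smooth_spacetime_on ::
  "nat \<Rightarrow> real set \<Rightarrow> (nat \<Rightarrow> real) set \<Rightarrow> (real \<Rightarrow> (nat \<Rightarrow> real) \<Rightarrow> real) \<Rightarrow> bool" where
  "smooth_spacetime_on n J V F \<longleftrightarrow> (\<forall>k. Ck_spacetime_on n J V k F)"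


section \<open>Smooth manifolds\<close>

text \<open>A chart is a pair of its domain and its coordinate map.\<close>

type_synonym 'a chart = "'a set \<times> ('a \<Rightarrow> nat \<Rightarrow> real)"

abbreviation chart_image :: "'a chart \<Rightarrow> (nat \<Rightarrow> real) set" where
  "chart_image c \<equiv> snd c ` fst c"

definition chart_inv :: "'a chart \<Rightarrow> (nat \<Rightarrow> real) \<Rightarrow> 'a" where
  "chart_inv c = inv_into (fst c) (snd c)"

definition is_chart :: "nat \<Rightarrow> 'a topology \<Rightarrow> 'a chart \<Rightarrow> bool" where
  "is_chart n X c \<longleftrightarrow>
     openin X (fst c) \<and> openin (Euclidean_space n) (chart_image c) \<and>
     homeomorphic_map (subtopology X (fst c)) (subtopology (Euclidean_space n) (chart_image c))
       (snd c)"

definition smooth_atlas :: "nat \<Rightarrow> 'a topology \<Rightarrow> 'a chart set \<Rightarrow> bool" where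
  "smooth_atlas n X A \<longleftrightarrow>
     (\<forall>c\<in>A. is_chart n X c) \<and> (\<Union>c\<in>A. fst c) = topspace X \<and>
     (\<forall>c\<in>A. \<forall>d\<in>A. \<forall>i<n.
        smooth_on_open n (snd c ` (fst c \<inter> fst d)) (\<lambda>x. snd d (chart_inv c x) i))"

definition closed_manifold :: "nat \<Rightarrow> 'a topology \<Rightarrow> 'a chart set \<Rightarrow> bool" where
  "closed_manifold n X A \<longleftrightarrow>
     Hausdorff_space X \<and> second_countable X \<and> compact_space X \<and> smooth_atlas n X A"


section \<open>Tensor fields\<close>

text \<open>
  The coordinate expression of a covariant tensor assigns a function of the coordinates to each
  multi-index (a list of indices below \<open>n\<close>). A tensor field is the family of its coordinate
  expressions in the charts of the atlas, related by the tensor transformation law.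
\<close>

type_synonym tensor = "nat list \<Rightarrow> (nat \<Rightarrow> real) \<Rightarrow> real"

type_synonym 'a tensor_field = "'a chart \<Rightarrow> tensor"

definition multi_indices :: "nat \<Rightarrow> nat \<Rightarrow> nat list set" where
  "multi_indices n k = {is. length is = k \<and> set is \<subseteq> {..<n}}"

definition is_tensor_field :: "nat \<Rightarrow> 'a chart set \<Rightarrow> nat \<Rightarrow> 'a tensor_field \<Rightarrow> bool" where
  "is_tensor_field n A k S \<longleftrightarrow>
     (\<forall>c\<in>A. \<forall>d\<in>A. \<forall>p\<in>fst c \<inter> fst d. \<forall>is\<in>multi_indices n k.
        S c is (snd c p) =
          (\<Sum>js\<in>multi_indices n k.
             (\<Prod>a<k. coord_partial (is ! a) (\<lambda>x. snd d (chart_inv c x) (js ! a)) (snd c p))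
             * S d js (snd d p)))"

definition smooth_tensor_family ::
  "nat \<Rightarrow> 'a chart set \<Rightarrow> real set \<Rightarrow> nat \<Rightarrow> (real \<Rightarrow> 'a tensor_field) \<Rightarrow> bool" where
  "smooth_tensor_family n A J k S \<longleftrightarrow>
     (\<forall>t\<in>J. is_tensor_field n A k (S t)) \<and>
     (\<forall>c\<in>A. \<forall>is\<in>multi_indices n k.
        smooth_spacetime_on n J (chart_image c) (\<lambda>t. S t c is))"

definition alternating :: "nat \<Rightarrow> 'a chart set \<Rightarrow> nat \<Rightarrow> 'a tensor_field \<Rightarrow> bool" where
  "alternating n A k S \<longleftrightarrow>
     (\<forall>c\<in>A. \<forall>x\<in>chart_image c. \<forall>is\<in>multi_indices n k. \<forall>a<k. \<forall>b<k. a \<noteq> b \<longrightarrow>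
        S c (is[a := is ! b, b := is ! a]) x = - S c is x)"

definition riemannian_metric :: "nat \<Rightarrow> 'a chart set \<Rightarrow> 'a tensor_field \<Rightarrow> bool" where
  "riemannian_metric n A g \<longleftrightarrow>
     is_tensor_field n A 2 g \<and>
     (\<forall>c\<in>A. \<forall>x\<in>chart_image c.
        (\<forall>i<n. \<forall>j<n. g c [i, j] x = g c [j, i] x) \<and>
        (\<forall>v. (\<exists>i<n. v i \<noteq> 0) \<longrightarrow> (\<Sum>i<n. \<Sum>j<n. g c [i, j] x * v i * v j) > 0))"


section \<open>Curvature and differential operators in coordinates\<close>

text \<open>Throughout this section \<open>G\<close> is the coordinate expression of a Riemannian metric.\<close>

definition metric_mat :: "nat \<Rightarrow> tensor \<Rightarrow> (nat \<Rightarrow> real) \<Rightarrow> real mat" where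
  "metric_mat n G x = Matrix.mat n n (\<lambda>(i, j). G [i, j] x)"

definition inv_metric :: "nat \<Rightarrow> tensor \<Rightarrow> nat \<Rightarrow> nat \<Rightarrow> (nat \<Rightarrow> real) \<Rightarrow> real" where
  "inv_metric n G i j x =
     (THE B. B \<in> carrier_mat n n \<and> inverts_mat (metric_mat n G x) B) $$ (i, j)"

text \<open>\<open>christoffel n G k i j\<close> is $\Gamma^k_{ij}$.\<close>

definition christoffel :: "nat \<Rightarrow> tensor \<Rightarrow> nat \<Rightarrow> nat \<Rightarrow> nat \<Rightarrow> (nat \<Rightarrow> real) \<Rightarrow> real" where
  "christoffel n G k i j x =
     (1 / 2) * (\<Sum>l<n. inv_metric n G k l x *
        (coord_partial i (G [j, l]) x + coord_partial j (G [i, l]) x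
           - coord_partial l (G [i, j]) x))"

text \<open>
  \<open>riemann n G l i j k\<close> is $R_{ijk}{}^l$, where
  $R(\partial_i, \partial_j)\partial_k = \nabla_i\nabla_j\partial_k - \nabla_j\nabla_i\partial_k
    = \sum_l R_{ijk}{}^l\, \partial_l$. With this convention $\mathrm{Ric}_{jk} = \sum_i R_{ijk}{}^i$
  is positive on round spheres.
\<close>

definition riemann :: "nat \<Rightarrow> tensor \<Rightarrow> nat \<Rightarrow> nat \<Rightarrow> nat \<Rightarrow> nat \<Rightarrow> (nat \<Rightarrow> real) \<Rightarrow> real" where
  "riemann n G l i j k x =
     coord_partial i (christoffel n G l j k) x - coord_partial j (christoffel n G l i k) x
     + (\<Sum>m<n. christoffel n G m j k x * christoffel n G l i m x
             - christoffel n G m i k x * christoffel n G l j m x)"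

definition ricci :: "nat \<Rightarrow> tensor \<Rightarrow> nat \<Rightarrow> nat \<Rightarrow> (nat \<Rightarrow> real) \<Rightarrow> real" where
  "ricci n G j k x = (\<Sum>i<n. riemann n G i i j k x)"

text \<open>The norm of the curvature tensor is the full tensor norm of $R_{ijkl} = g_{lm} R_{ijk}{}^m$.\<close>

definition riemann_lowered :: "nat \<Rightarrow> tensor \<Rightarrow> tensor" where
  "riemann_lowered n G is x =
     (\<Sum>m<n. G [is ! 3, m] x * riemann n G m (is ! 0) (is ! 1) (is ! 2) x)"

definition tensor_norm :: "nat \<Rightarrow> tensor \<Rightarrow> nat \<Rightarrow> tensor \<Rightarrow> (nat \<Rightarrow> real) \<Rightarrow> real" where
  "tensor_norm n G k S x =
     sqrt (\<Sum>is\<in>multi_indices n k. \<Sum>js\<in>multi_indices n k.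
             (\<Prod>a<k. inv_metric n G (is ! a) (js ! a) x) * S is x * S js x)"

definition rm_norm :: "nat \<Rightarrow> tensor \<Rightarrow> (nat \<Rightarrow> real) \<Rightarrow> real" where
  "rm_norm n G x = tensor_norm n G 4 (riemann_lowered n G) x"

definition laplacian :: "nat \<Rightarrow> tensor \<Rightarrow> ((nat \<Rightarrow> real) \<Rightarrow> real) \<Rightarrow> (nat \<Rightarrow> real) \<Rightarrow> real" where
  "laplacian n G u x =
     (\<Sum>i<n. \<Sum>j<n. inv_metric n G i j x *
        (coord_partial i (coord_partial j u) x
           - (\<Sum>k<n. christoffel n G k i j x * coord_partial k u x)))"

text \<open>
  The exterior derivative
  $(d\omega)_{i_0\dots i_k} = \sum_a (-1)^a\, \partial_{i_a}\omega_{i_0\dots\widehat{i_a}\dots i_k}$.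
\<close>

definition ext_deriv :: "tensor \<Rightarrow> tensor" where
  "ext_deriv S is x =
     (\<Sum>a<length is. (- 1) ^ a * coord_partial (is ! a) (S (take a is @ drop (Suc a) is)) x)"

text \<open>\<open>cov_deriv n G m S is\<close> is $(\nabla_m S)_{is}$ for the Levi-Civita connection.\<close>

definition cov_deriv :: "nat \<Rightarrow> tensor \<Rightarrow> nat \<Rightarrow> tensor \<Rightarrow> tensor" where
  "cov_deriv n G m S is x =
     coord_partial m (S is) x
     - (\<Sum>a<length is. \<Sum>l<n. christoffel n G l m (is ! a) x * S (is[a := l]) x)"

text \<open>The codifferential $(d^*\omega)_{i_1\dots i_k} = - g^{lm}\nabla_l\omega_{m i_1\dots i_k}$.\<close>

definition codiff :: "nat \<Rightarrow> tensor \<Rightarrow> tensor \<Rightarrow> tensor" where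
  "codiff n G S is x =
     - (\<Sum>l<n. \<Sum>m<n. inv_metric n G l m x * cov_deriv n G l S (m # is) x)"

definition hodge_laplacian :: "nat \<Rightarrow> tensor \<Rightarrow> tensor \<Rightarrow> tensor" where
  "hodge_laplacian n G S is x =
     ext_deriv (codiff n G S) is x + codiff n G (ext_deriv S) is x"

definition H_square :: "nat \<Rightarrow> tensor \<Rightarrow> tensor \<Rightarrow> nat \<Rightarrow> nat \<Rightarrow> (nat \<Rightarrow> real) \<Rightarrow> real" where
  "H_square n G H i j x =
     (\<Sum>p<n. \<Sum>q<n. \<Sum>k<n. \<Sum>l<n.
        inv_metric n G p q x * inv_metric n G k l x * H [i, p, k] x * H [j, q, l] x)"

definition H_norm_sq :: "nat \<Rightarrow> tensor \<Rightarrow> tensor \<Rightarrow> (nat \<Rightarrow> real) \<Rightarrow> real" where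
  "H_norm_sq n G H x = (\<Sum>i<n. \<Sum>j<n. inv_metric n G i j x * H_square n G H i j x)"

definition closed_form :: "nat \<Rightarrow> 'a chart set \<Rightarrow> nat \<Rightarrow> 'a tensor_field \<Rightarrow> bool" where
  "closed_form n A k S \<longleftrightarrow>
     (\<forall>c\<in>A. \<forall>x\<in>chart_image c. \<forall>is\<in>multi_indices n (Suc k). ext_deriv (S c) is x = 0)"


section \<open>Riemannian distance and volume\<close>

definition piecewise_C1_curve ::
  "nat \<Rightarrow> 'a topology \<Rightarrow> 'a chart set \<Rightarrow> (real \<Rightarrow> 'a) \<Rightarrow> bool" where
  "piecewise_C1_curve n X A \<gamma> \<longleftrightarrow>
     continuous_map (top_of_set {0..1}) X \<gamma> \<and>
     (\<exists>S. finite S \<and> (\<forall>c\<in>A. \<forall>i<n.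
        (\<lambda>s. snd c (\<gamma> s) i) C1_differentiable_on {s \<in> {0..1} - S. \<gamma> s \<in> fst c}))"

text \<open>
  The speed $|\gamma'(s)|_g$ does not depend on the chart around \<open>\<gamma> s\<close>, by the transformation
  law, so that an arbitrary one may be chosen.
\<close>

definition curve_speed ::
  "nat \<Rightarrow> 'a chart set \<Rightarrow> 'a tensor_field \<Rightarrow> (real \<Rightarrow> 'a) \<Rightarrow> real \<Rightarrow> real" where
  "curve_speed n A g \<gamma> s =
     (let c = (SOME c. c \<in> A \<and> \<gamma> s \<in> fst c);
          v = (\<lambda>i. vector_derivative (\<lambda>s'. snd c (\<gamma> s') i) (at s))
      in sqrt (\<Sum>i<n. \<Sum>j<n. g c [i, j] (snd c (\<gamma> s)) * v i * v j))"

definition curve_length ::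
  "nat \<Rightarrow> 'a chart set \<Rightarrow> 'a tensor_field \<Rightarrow> (real \<Rightarrow> 'a) \<Rightarrow> ennreal" where
  "curve_length n A g \<gamma> = (\<integral>\<^sup>+s\<in>{0..1}. ennreal (curve_speed n A g \<gamma> s) \<partial>lborel)"

text \<open>The distance is \<open>\<infinity>\<close> between points of different connected components.\<close>

definition riemannian_dist ::
  "nat \<Rightarrow> 'a topology \<Rightarrow> 'a chart set \<Rightarrow> 'a tensor_field \<Rightarrow> 'a \<Rightarrow> 'a \<Rightarrow> ennreal" where
  "riemannian_dist n X A g p q =
     (INF \<gamma>\<in>{\<gamma>. piecewise_C1_curve n X A \<gamma> \<and> \<gamma> 0 = p \<and> \<gamma> 1 = q}. curve_length n A g \<gamma>)"

definition riemannian_ball ::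
  "nat \<Rightarrow> 'a topology \<Rightarrow> 'a chart set \<Rightarrow> 'a tensor_field \<Rightarrow> 'a \<Rightarrow> real \<Rightarrow> 'a set" where
  "riemannian_ball n X A g p r =
     {q \<in> topspace X. riemannian_dist n X A g p q < ennreal r}"

text \<open>
  For a Borel set \<open>E\<close> inside the domain of the chart \<open>c\<close>, \<open>chart_volume n g c E\<close> is the
  integral of $\sqrt{\det g_{ij}}$ over the coordinate image of \<open>E\<close>. The product
  measure lives on functions that are undefined at indices \<open>i \<ge> n\<close>, hence the conversion.
\<close>

definition chart_volume :: "nat \<Rightarrow> 'a tensor_field \<Rightarrow> 'a chart \<Rightarrow> 'a set \<Rightarrow> ennreal" where
  "chart_volume n g c E =
     (\<integral>\<^sup>+y. (let x = (\<lambda>i. if i < n then y i else 0)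
            in ennreal (sqrt (Determinant.det (metric_mat n (g c) x))) * indicator (snd c ` E) x)
        \<partial>(\<Pi>\<^sub>M i\<in>{..<n}. (lborel :: real measure)))"

text \<open>
  A Borel set \<open>B\<close> of a second countable manifold is a countable disjoint union of Borel
  sets that each lie in a chart domain. So its Riemannian volume is the supremum of the total
  volume of finitely many disjoint Borel subsets of \<open>B\<close> that each lie in a chart domain.
\<close>

definition riemannian_volume ::
  "'a topology \<Rightarrow> nat \<Rightarrow> 'a chart set \<Rightarrow> 'a tensor_field \<Rightarrow> 'a set \<Rightarrow> ennreal" where
  "riemannian_volume X n A g B =
     (SUP P\<in>{P. finite P \<and> disjoint_family_on fst P \<and>
               (\<forall>(E, c)\<in>P. c \<in> A \<and> E \<in> sigma_sets (topspace X) {W. openin X W} \<and>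
                            E \<subseteq> fst c \<and> E \<subseteq> B)}.
        \<Sum>(E, c)\<in>P. chart_volume n g c E)"


section \<open>Generalized Ricci flow\<close>

definition generalized_ricci_flow ::
  "nat \<Rightarrow> 'a chart set \<Rightarrow> real \<Rightarrow> (real \<Rightarrow> 'a tensor_field) \<Rightarrow> (real \<Rightarrow> 'a tensor_field) \<Rightarrow> bool"
  where
  "generalized_ricci_flow n A T g H \<longleftrightarrow>
     smooth_tensor_family n A {0..<T} 2 g \<and>
     smooth_tensor_family n A {0..<T} 3 H \<and>
     (\<forall>t\<in>{0..<T}. riemannian_metric n A (g t) \<and>
                  alternating n A 3 (H t) \<and> closed_form n A 3 (H t)) \<and>
     (\<forall>t\<in>{0..<T}. \<forall>c\<in>A. \<forall>x\<in>chart_image c.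
        (\<forall>i<n. \<forall>j<n.
           ((\<lambda>s. g s c [i, j] x) has_real_derivative
              - 2 * ricci n (g t c) i j x + (1 / 2) * H_square n (g t c) (H t c) i j x)
             (at t within {0..<T})) \<and>
        (\<forall>is\<in>multi_indices n 3.
           ((\<lambda>s. H s c is x) has_real_derivative - hodge_laplacian n (g t c) (H t c) is x)
             (at t within {0..<T})))"

definition non_collapsing ::
  "nat \<Rightarrow> 'a topology \<Rightarrow> 'a chart set \<Rightarrow> real \<Rightarrow> (real \<Rightarrow> 'a tensor_field) \<Rightarrow> bool" where
  "non_collapsing n X A T g \<longleftrightarrow>
     (\<exists>\<kappa>>0. \<forall>p\<in>topspace X. \<forall>t\<in>{0..<T}. \<forall>r. 0 < r \<and> r \<le> sqrt T \<longrightarrow>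
        (\<forall>q\<in>riemannian_ball n X A (g t) p r. \<forall>c\<in>A. q \<in> fst c \<longrightarrow>
            rm_norm n (g t c) (snd c q) \<le> 1 / r ^ 2) \<longrightarrow>
        riemannian_volume X n A (g t) (riemannian_ball n X A (g t) p r) \<ge> ennreal (\<kappa> * r ^ n))"

definition torsion_bounding ::
  "nat \<Rightarrow> 'a topology \<Rightarrow> 'a chart set \<Rightarrow> real \<Rightarrow> (real \<Rightarrow> 'a tensor_field) \<Rightarrow>
     (real \<Rightarrow> 'a tensor_field) \<Rightarrow> (real \<Rightarrow> 'a \<Rightarrow> real) \<Rightarrow> bool" where
  "torsion_bounding n X A T g H \<psi> \<longleftrightarrow>
     (\<forall>c\<in>A. smooth_spacetime_on n {0..<T} (chart_image c) (\<lambda>t x. \<psi> t (chart_inv c x))) \<and>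
     (\<forall>t\<in>{0..<T}. \<forall>p\<in>topspace X. \<psi> t p \<ge> 0) \<and>
     (\<forall>t\<in>{0..<T}. \<forall>c\<in>A. \<forall>x\<in>chart_image c.
        time_deriv {0..<T} (\<lambda>s y. \<psi> s (chart_inv c y)) t x
          - laplacian n (g t c) (\<lambda>y. \<psi> t (chart_inv c y)) x
        \<le> - H_norm_sq n (g t c) (H t c) x)"

end

(*
  On S^2 x S^1 consider g = a g_{S^2} + b ds^2 and H = vol_{S^2} wedge ds. As H is parallel, the
  generalized Ricci flow reduces to a' = -2 + 1/(ab), b' = 1/a^2. It has the solution a = 1 - t,
  b = 1/(1 - t), for which |H|^2 = 6/(1 - t) is not integrable in time up to t = 1. If psi were a
  torsion-bounding function, then by the maximum principle psi - 6 ln(1 - t) would stay below its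
  initial maximum, so that psi would become negative near t = 1. The flow is non-collapsing, since
  |Rm| is at least 1/a while the circle only gets longer: a ball on which |Rm| <= 1/r^2 has
  r <= sqrt a, and up to a fixed factor it contains the product of a disc and an interval of size r.
*)

theory Submission
  imports Defs
begin


section \<open>Rational functions are smooth\<close>

text \<open>The choice of a and b comes from (ab)' = 2(1 - ab)/a: the condition ab = 1 is preserved,
  and then only a' = -1 remains. The obstacle is the bookkeeping between charts. S^2 x S^1 sits in
  R^5 and is covered by four products of stereographic projections, whose signs are chosen such that
  every change of coordinates preserves the orientation: it is 1/z or the identity on the sphere,
  and -1/u or the identity on the circle. Hence g and H have the same coordinate expression in all
  four charts, each chart has all of R^3 as its image, and every local identity is checked only
  once. These expressions are rational in t and the coordinates, with denominators that do not
  vanish, so that smoothness follows from one induction over rational functions. In the maximum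
  principle a further term -t makes the differential inequality strict; then the derivative tests at
  a maximum in space and time suffice.\<close>

lemma Euclidean_space_eq: "Euclidean_space n = top_of_set {x. \<forall>i\<ge>n. x i = 0}"
  by (simp add: Euclidean_space_def euclidean_product_topology)

lemma openin_imp_subset_Euclidean_space:
  "openin (Euclidean_space n) V \<Longrightarrow> V \<subseteq> {x. \<forall>i\<ge>n. x i = 0}"
  by (metis openin_subset topspace_Euclidean_space)

lemma subtopology_Euclidean_space:
  "openin (Euclidean_space n) V \<Longrightarrow> subtopology (Euclidean_space n) V = top_of_set V"
  using openin_imp_subset_Euclidean_space[of n V]
  by (simp add: Euclidean_space_eq subtopology_subtopology inf.absorb2)

text \<open>\<open>coord_partial\<close> differentiates along lines in the whole function type,
  where a function may be arbitrary off \<open>V\<close>. For \<open>i < n\<close> the line stays in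
  the subspace, and so near \<open>x i\<close> in the relatively open set \<open>V\<close>. This
  makes coordinate derivatives local in \<open>V\<close>.\<close>

lemma eventually_update_in:
  assumes "openin (Euclidean_space n) V" "x \<in> V" "i < n"
  shows "eventually (\<lambda>s. x(i := s) \<in> V) (nhds (x i))"
proof -
  obtain U where U: "open U" "V = {x. \<forall>i\<ge>n. x i = 0} \<inter> U"
    using assms(1) unfolding Euclidean_space_eq openin_open by blast
  have "continuous_on UNIV (\<lambda>s::real. x(i := s))"
  proof (rule continuous_on_coordinatewise_then_product)
    show "continuous_on UNIV (\<lambda>s. (x(i := s)) j)" for j
      by (cases "j = i") (auto intro!: continuous_intros)
  qed
  then have "open ((\<lambda>s. x(i := s)) -` U)"
    using U(1) by (simp add: continuous_on_open_vimage)
  moreover have "x i \<in> (\<lambda>s. x(i := s)) -` U"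
    using assms U by auto
  ultimately have "eventually (\<lambda>s. s \<in> (\<lambda>s. x(i := s)) -` U) (nhds (x i))"
    by (rule eventually_nhds_in_open)
  then show ?thesis
    using assms U by (auto elim!: eventually_mono)
qed

text \<open>The common route to explicit partial derivatives below: a function known only on
  \<open>V\<close> is replaced by a formula before differentiating.\<close>

lemma coord_partial_eqI:
  assumes "openin (Euclidean_space n) V" "x \<in> V" "i < n" "\<And>y. y \<in> V \<Longrightarrow> F y = f y"
    and "((\<lambda>s. f (x(i := s))) has_real_derivative D) (at (x i))"
  shows "((\<lambda>s. F (x(i := s))) has_real_derivative D) (at (x i))" "coord_partial i F x = D"
proof -
  have "eventually (\<lambda>s. F (x(i := s)) = f (x(i := s))) (nhds (x i))"
    using eventually_update_in[OF assms(1-3)] by eventually_elim (simp add: assms(4))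
  then show "((\<lambda>s. F (x(i := s))) has_real_derivative D) (at (x i))"
    using assms(5) by (subst DERIV_cong_ev[OF refl _ refl])
  then show "coord_partial i F x = D"
    unfolding coord_partial_def by (rule DERIV_imp_deriv)
qed

text \<open>This class contains all component functions of the example and is closed under time and
  coordinate derivatives, so that membership yields derivatives of every order. Denominators have to
  be nonzero only for times in \<open>J\<close> and points of \<open>V\<close>.\<close>

inductive rational_on :: "real set \<Rightarrow> (nat \<Rightarrow> real) set \<Rightarrow> (real \<Rightarrow> (nat \<Rightarrow> real) \<Rightarrow> real) \<Rightarrow> bool"
  for J V where
  const: "rational_on J V (\<lambda>t x. c)"
| time: "rational_on J V (\<lambda>t x. t)"
| coord: "rational_on J V (\<lambda>t x. x i)"
| add: "rational_on J V F \<Longrightarrow> rational_on J V G \<Longrightarrow> rational_on J V (\<lambda>t x. F t x + G t x)"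
| mult: "rational_on J V F \<Longrightarrow> rational_on J V G \<Longrightarrow> rational_on J V (\<lambda>t x. F t x * G t x)"
| inverse: "rational_on J V F \<Longrightarrow> (\<And>t x. t \<in> J \<Longrightarrow> x \<in> V \<Longrightarrow> F t x \<noteq> 0) \<Longrightarrow>
    rational_on J V (\<lambda>t x. inverse (F t x))"

lemma rational_on_minus: "rational_on J V F \<Longrightarrow> rational_on J V (\<lambda>t x. - F t x)"
  using rational_on.mult[OF rational_on.const[of J V "-1"]] by simp

lemma rational_on_diff:
  "rational_on J V F \<Longrightarrow> rational_on J V G \<Longrightarrow> rational_on J V (\<lambda>t x. F t x - G t x)"
  using rational_on.add[OF _ rational_on_minus] by fastforce

lemma rational_on_divide:
  "rational_on J V F \<Longrightarrow> rational_on J V G \<Longrightarrow> (\<And>t x. t \<in> J \<Longrightarrow> x \<in> V \<Longrightarrow> G t x \<noteq> 0) \<Longrightarrow>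
    rational_on J V (\<lambda>t x. F t x / G t x)"
  using rational_on.mult[OF _ rational_on.inverse] by (simp add: divide_inverse)

lemma rational_on_power: "rational_on J V F \<Longrightarrow> rational_on J V (\<lambda>t x. F t x ^ k)"
  by (induction k) (auto intro: rational_on.intros)

lemmas rational_on_intros =
  rational_on.intros rational_on_minus rational_on_diff rational_on_divide rational_on_power

lemma rational_on_continuous:
  "rational_on J V F \<Longrightarrow> continuous_on (J \<times> V) (\<lambda>(t, x). F t x)"
proof (induction rule: rational_on.induct)
  case (coord i)
  have "continuous_on (J \<times> V) (\<lambda>p. snd p i)"
    by (rule continuous_on_product_then_coordinatewise) (intro continuous_intros)
  then show ?case by (simp add: case_prod_unfold)
qed (auto simp: case_prod_unfold intro!: continuous_intros)

lemma rational_on_time_derivative: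
  "rational_on J V F \<Longrightarrow> \<exists>F'. rational_on J V F' \<and>
     (\<forall>t\<in>J. \<forall>x\<in>V. ((\<lambda>s. F s x) has_real_derivative F' t x) (at t within J))"
proof (induction rule: rational_on.induct)
  case (const c)
  show ?case by (rule exI[of _ "\<lambda>t x. 0"]) (auto intro: rational_on.intros)
next
  case time
  show ?case by (rule exI[of _ "\<lambda>t x. 1"]) (auto intro: rational_on.intros)
next
  case (coord i)
  show ?case by (rule exI[of _ "\<lambda>t x. 0"]) (auto intro: rational_on.intros)
next
  case (add F G)
  then obtain F' G' where FG: "rational_on J V F'" "rational_on J V G'"
    "\<forall>t\<in>J. \<forall>x\<in>V. ((\<lambda>s. F s x) has_real_derivative F' t x) (at t within J)"
    "\<forall>t\<in>J. \<forall>x\<in>V. ((\<lambda>s. G s x) has_real_derivative G' t x) (at t within J)" by blast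
  show ?case
    by (rule exI[of _ "\<lambda>t x. F' t x + G' t x"])
      (intro conjI ballI rational_on.add DERIV_add; use FG in blast)
next
  case (mult F G)
  then obtain F' G' where FG: "rational_on J V F'" "rational_on J V G'"
    "\<forall>t\<in>J. \<forall>x\<in>V. ((\<lambda>s. F s x) has_real_derivative F' t x) (at t within J)"
    "\<forall>t\<in>J. \<forall>x\<in>V. ((\<lambda>s. G s x) has_real_derivative G' t x) (at t within J)" by blast
  show ?case
    by (rule exI[of _ "\<lambda>t x. F t x * G' t x + F' t x * G t x"])
      (use FG mult in \<open>auto intro!: rational_on.intros DERIV_mult'\<close>)
next
  case (inverse F)
  then obtain F' where F: "rational_on J V F'"
    "\<forall>t\<in>J. \<forall>x\<in>V. ((\<lambda>s. F s x) has_real_derivative F' t x) (at t within J)" by blast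
  show ?case
    by (rule exI[of _ "\<lambda>t x. - (inverse (F t x) * F' t x * inverse (F t x))"])
      (use F inverse in \<open>auto intro!: rational_on_intros DERIV_inverse'\<close>)
qed

lemma rational_on_partial:
  "rational_on J V F \<Longrightarrow> \<exists>F'. rational_on J V F' \<and>
     (\<forall>t\<in>J. \<forall>x\<in>V. ((\<lambda>s. F t (x(i := s))) has_real_derivative F' t x) (at (x i)))"
proof (induction rule: rational_on.induct)
  case (const c)
  show ?case by (rule exI[of _ "\<lambda>t x. 0"]) (auto intro: rational_on.intros)
next
  case time
  show ?case by (rule exI[of _ "\<lambda>t x. 0"]) (auto intro: rational_on.intros)
next
  case (coord k)
  show ?case
    by (rule exI[of _ "\<lambda>t x. if k = i then 1 else 0"]) (auto intro: rational_on.intros)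
next
  case (add F G)
  then obtain F' G' where FG: "rational_on J V F'" "rational_on J V G'"
    "\<forall>t\<in>J. \<forall>x\<in>V. ((\<lambda>s. F t (x(i := s))) has_real_derivative F' t x) (at (x i))"
    "\<forall>t\<in>J. \<forall>x\<in>V. ((\<lambda>s. G t (x(i := s))) has_real_derivative G' t x) (at (x i))" by blast
  show ?case
    by (rule exI[of _ "\<lambda>t x. F' t x + G' t x"])
      (intro conjI ballI rational_on.add DERIV_add; use FG in blast)
next
  case (mult F G)
  then obtain F' G' where FG: "rational_on J V F'" "rational_on J V G'"
    "\<forall>t\<in>J. \<forall>x\<in>V. ((\<lambda>s. F t (x(i := s))) has_real_derivative F' t x) (at (x i))"
    "\<forall>t\<in>J. \<forall>x\<in>V. ((\<lambda>s. G t (x(i := s))) has_real_derivative G' t x) (at (x i))" by blast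
  \<comment> \<open>The product rule yields values at \<open>x(i := x i)\<close>, which have to be
    simplified to values at \<open>x\<close>; hence the explicit instance.\<close>
  have "((\<lambda>s. F t (x(i := s)) * G t (x(i := s))) has_real_derivative F t x * G' t x + F' t x * G t
      x) (at (x i))"
    if "t \<in> J" "x \<in> V" for t x
    using DERIV_mult'[of "\<lambda>s. F t (x(i := s))" _ "x i" UNIV "\<lambda>s. G t (x(i := s))"] that FG(3,4) by
        simp
  then show ?case
    by (intro exI[of _ "\<lambda>t x. F t x * G' t x + F' t x * G t x"] conjI ballI rational_on.add
        rational_on.mult)
      (use FG mult in blast)+
next
  case (inverse F)
  then obtain F' where F: "rational_on J V F'"
    "\<forall>t\<in>J. \<forall>x\<in>V. ((\<lambda>s. F t (x(i := s))) has_real_derivative F' t x) (at (x i))" by blast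
  have "((\<lambda>s. inverse (F t (x(i := s)))) has_real_derivative - (inverse (F t x) * F' t x * inverse
      (F t x))) (at (x i))"
    if "t \<in> J" "x \<in> V" for t x
    using DERIV_inverse'[of "\<lambda>s. F t (x(i := s))" _ "x i" UNIV] that F(2) inverse by simp
  then show ?case
    by (intro exI[of _ "\<lambda>t x. - (inverse (F t x) * F' t x * inverse (F t x))"] conjI ballI
          rational_on_minus rational_on.mult rational_on.inverse)
      (use F inverse in blast)+
qed


text \<open>The induction runs over all pairs \<open>F\<close>, \<open>F'\<close>: the derivatives
  of \<open>F\<close> are known only on \<open>J \<times> V\<close>, where they agree with those of
  \<open>F'\<close>, which are rational again. The time derivative within \<open>J\<close> is unique
  because no point of \<open>J\<close> is isolated.\<close>

lemma Ck_spacetime_on_rational: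
  assumes V: "openin (Euclidean_space n) V" and J: "\<And>t. t \<in> J \<Longrightarrow> at t within J \<noteq> bot"
    and "rational_on J V F'" "\<And>t x. t \<in> J \<Longrightarrow> x \<in> V \<Longrightarrow> F t x = F' t x"
  shows "Ck_spacetime_on n J V k F"
  using assms(3,4)
proof (induction k arbitrary: F F')
  case 0
  have "continuous_on (J \<times> V) (\<lambda>(t, x). F t x)"
    using rational_on_continuous[OF 0(1)] by (rule continuous_on_eq) (auto simp: 0(2))
  then show ?case
    by (simp add: subtopology_Euclidean_space[OF V] prod_topology_subtopology_eu)
next
  case (Suc k)
  have "continuous_on (J \<times> V) (\<lambda>(t, x). F t x)"
    using rational_on_continuous[OF Suc(2)] by (rule continuous_on_eq) (auto simp: Suc(3))
  then have *: "continuous_map (prod_topology (top_of_set J) (subtopology (Euclidean_space n) V))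
      euclideanreal (\<lambda>(t, x). F t x)"
    by (simp add: subtopology_Euclidean_space[OF V] prod_topology_subtopology_eu)
  obtain D where D: "rational_on J V D"
    "\<forall>t\<in>J. \<forall>x\<in>V. ((\<lambda>s. F' s x) has_real_derivative D t x) (at t within J)"
    using rational_on_time_derivative[OF Suc(2)] by blast
  have D': "((\<lambda>s. F s x) has_vector_derivative D t x) (at t within J)" if "t \<in> J" "x \<in> V" for t x
    using has_vector_derivative_transform[of t J "\<lambda>s. F s x" "\<lambda>s. F' s x" "D t x"]
      D(2)[rule_format, OF that] Suc(3)[OF _ that(2)] that(1)
    by (simp add: has_real_derivative_iff_has_vector_derivative)
  have 1: "Ck_spacetime_on n J V k (time_deriv J F)"
    by (rule Suc(1)[OF D(1)])
      (auto simp: time_deriv_def intro!: vector_derivative_within J D')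
  have 2: "(\<forall>t\<in>J. \<forall>x\<in>V. (\<lambda>s. F t (x(i := s))) field_differentiable (at (x i))) \<and>
            Ck_spacetime_on n J V k (\<lambda>t. coord_partial i (F t))" if i: "i < n" for i
  proof -
    obtain P where P: "rational_on J V P"
      "\<forall>t\<in>J. \<forall>x\<in>V. ((\<lambda>s. F' t (x(i := s))) has_real_derivative P t x) (at (x i))"
      using rational_on_partial[OF Suc(2)] by blast
    have P': "((\<lambda>s. F t (x(i := s))) has_real_derivative P t x) (at (x i))"
      "coord_partial i (F t) x = P t x" if "t \<in> J" "x \<in> V" for t x
      using coord_partial_eqI[OF V that(2) i Suc(3)[OF that(1)] P(2)[rule_format, OF that]] by
          blast+
    then show ?thesis
      using Suc(1)[OF P(1), of "\<lambda>t. coord_partial i (F t)"] by (auto simp: field_differentiable_def)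
  qed
  show ?case
    using * 1 2 differentiableI_vector[OF D'] by simp
qed

text \<open>Passing to a time slice lets the atlas, where no time occurs, use the same induction
  with functions constant in time.\<close>

lemma Ck_on_of_spacetime:
  "Ck_spacetime_on n J V k F \<Longrightarrow> t \<in> J \<Longrightarrow> Ck_on n V k (F t)"
proof (induction k arbitrary: F)
  case 0
  then have "continuous_map (subtopology (Euclidean_space n) V) euclideanreal ((\<lambda>(t, x). F t x) \<circ>
      (\<lambda>x. (t, x)))"
    by (intro continuous_map_compose) (auto simp: continuous_map_pairwise o_def)
  then show ?case by (simp add: o_def)
next
  case (Suc k)
  then have "continuous_map (subtopology (Euclidean_space n) V) euclideanreal ((\<lambda>(t, x). F t x) \<circ>
      (\<lambda>x. (t, x)))"
    by (intro continuous_map_compose) (auto simp: continuous_map_pairwise o_def)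
  moreover have "Ck_on n V k (coord_partial i (F t))" if "i < n" for i
    using Suc.IH[of "\<lambda>t. coord_partial i (F t)"] Suc.prems that by simp
  ultimately show ?case
    using Suc.prems by (simp add: o_def)
qed

lemma smooth_spacetime_on_rational:
  assumes "openin (Euclidean_space n) V" "\<And>t. t \<in> J \<Longrightarrow> at t within J \<noteq> bot"
    and "rational_on J V F'" "\<And>t x. t \<in> J \<Longrightarrow> x \<in> V \<Longrightarrow> F t x = F' t x"
  shows "smooth_spacetime_on n J V F"
  unfolding smooth_spacetime_on_def using Ck_spacetime_on_rational[OF assms] by blast

lemma smooth_on_open_rational:
  assumes "openin (Euclidean_space n) V" "rational_on UNIV V (\<lambda>t. F')" "\<And>x. x \<in> V \<Longrightarrow> F x = F' x"
  shows "smooth_on_open n V F"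
  unfolding smooth_on_open_def
  using Ck_on_of_spacetime[OF Ck_spacetime_on_rational[OF assms(1) _ assms(2), where F = "\<lambda>t. F"],
      of 0] assms(3)
  by simp


section \<open>Stereographic charts of the product of a sphere and a circle\<close>

abbreviation R3 :: "(nat \<Rightarrow> real) set" where
  "R3 \<equiv> {x. \<forall>i\<ge>3. x i = 0}"

definition sphere_circle :: "(nat \<Rightarrow> real) set" where
  "sphere_circle = {p. (\<forall>i\<ge>5. p i = 0) \<and> (p 0)\<^sup>2 + (p 1)\<^sup>2 + (p 2)\<^sup>2 = 1 \<and> (p 3)\<^sup>2 + (p 4)\<^sup>2 = 1}"

abbreviation sgns :: "real set" where
  "sgns \<equiv> {1, -1}"

definition stereo_dom :: "real \<Rightarrow> real \<Rightarrow> (nat \<Rightarrow> real) set" where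
  "stereo_dom e d = {p \<in> sphere_circle. p 2 \<noteq> e \<and> p 4 \<noteq> d}"

text \<open>Stereographic projections from the poles \<open>p 2 = e\<close> and
  \<open>p 4 = d\<close>. The factors \<open>e\<close> and \<open>d\<close> in the second and third
  coordinate orient the charts. Without them the coordinate changes would be z/|z|^2 and 1/u, each
  of which reverses the orientation and would change the sign of the volume form.\<close>

definition stereo :: "real \<Rightarrow> real \<Rightarrow> (nat \<Rightarrow> real) \<Rightarrow> nat \<Rightarrow> real" where
  "stereo e d p i =
     (if i = 0 then p 0 / (1 - e * p 2) else if i = 1 then e * p 1 / (1 - e * p 2)
      else if i = 2 then d * p 3 / (1 - d * p 4) else 0)"

definition unstereo :: "real \<Rightarrow> real \<Rightarrow> (nat \<Rightarrow> real) \<Rightarrow> nat \<Rightarrow> real" where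
  "unstereo e d x i =
     (if i = 0 then 2 * x 0 / (1 + (x 0)\<^sup>2 + (x 1)\<^sup>2)
      else if i = 1 then e * (2 * x 1 / (1 + (x 0)\<^sup>2 + (x 1)\<^sup>2))
      else if i = 2 then e * (1 - 2 / (1 + (x 0)\<^sup>2 + (x 1)\<^sup>2))
      else if i = 3 then d * (2 * x 2 / (1 + (x 2)\<^sup>2))
      else if i = 4 then d * (1 - 2 / (1 + (x 2)\<^sup>2)) else 0)"

definition stereo_chart :: "real \<Rightarrow> real \<Rightarrow> (nat \<Rightarrow> real) chart" where
  "stereo_chart e d = (stereo_dom e d, stereo e d)"

definition stereo_atlas :: "(nat \<Rightarrow> real) chart set" where
  "stereo_atlas = (\<Union>e\<in>sgns. \<Union>d\<in>sgns. {stereo_chart e d})"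

text \<open>
  The coordinate change \<open>z \<mapsto> 1/z\<close> on the sphere and \<open>z \<mapsto> -1/z\<close> on the circle, each
  applied only if the two charts omit different points. Both sides of
  \<open>stereo_unstereo_eq_transition\<close> are \<open>0\<close> where these are undefined.
\<close>

definition transition :: "bool \<Rightarrow> bool \<Rightarrow> (nat \<Rightarrow> real) \<Rightarrow> nat \<Rightarrow> real" where
  "transition a b x i =
     (if i = 0 then if a then x 0 else x 0 / ((x 0)\<^sup>2 + (x 1)\<^sup>2)
      else if i = 1 then if a then x 1 else - x 1 / ((x 0)\<^sup>2 + (x 1)\<^sup>2)
      else if i = 2 then if b then x 2 else - 1 / x 2 else 0)"

definition overlap :: "bool \<Rightarrow> bool \<Rightarrow> (nat \<Rightarrow> real) set" where
  "overlap a b = {x \<in> R3. (a \<or> (x 0)\<^sup>2 + (x 1)\<^sup>2 \<noteq> 0) \<and> (b \<or> x 2 \<noteq> 0)}"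

lemma one_plus_squares_pos: "0 < 1 + (x::real)\<^sup>2 + y\<^sup>2" "0 < 1 + (x::real)\<^sup>2"
  by (simp_all add: add_pos_nonneg)

lemma one_plus_squares_nz [simp]:
  "1 + (x::real)\<^sup>2 + y\<^sup>2 \<noteq> 0" "1 + ((x::real)\<^sup>2 + y\<^sup>2) \<noteq> 0" "1 + (x::real)\<^sup>2 \<noteq> 0"
  using one_plus_squares_pos[of x] by (metis less_irrefl add.assoc)+

text \<open>With c = \<open>e * p 2\<close>, the sphere equation gives |z|^2 = (1 - c)(1 + c)/(1 -
  c)^2 = (1 + c)/(1 - c). This formula gives both the inverse map and the bound |z| \<le> 1 on a
  hemisphere.\<close>

lemma stereo_squares:
  assumes "p \<in> stereo_dom e d" "e \<in> sgns" "d \<in> sgns"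
  shows "1 + (stereo e d p 0)\<^sup>2 + (stereo e d p 1)\<^sup>2 = 2 / (1 - e * p 2)"
    and "1 + (stereo e d p 2)\<^sup>2 = 2 / (1 - d * p 4)"
    and "1 - e * p 2 \<noteq> 0" "1 - d * p 4 \<noteq> 0"
proof -
  show u: "1 - e * p 2 \<noteq> 0" "1 - d * p 4 \<noteq> 0"
    using assms by (auto simp: stereo_dom_def)
  have "(p 0)\<^sup>2 + (p 1)\<^sup>2 + (p 2)\<^sup>2 = 1" "(p 3)\<^sup>2 + (p 4)\<^sup>2 = 1"
    using assms by (auto simp: stereo_dom_def sphere_circle_def)
  then have "(p 0)\<^sup>2 + (e * p 1)\<^sup>2 = (1 - e * p 2) * (1 + e * p 2)"
    "(d * p 3)\<^sup>2 = (1 - d * p 4) * (1 + d * p 4)"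
    using assms(2,3) by (auto simp: power2_eq_square algebra_simps)
  then have "(p 0 / (1 - e * p 2))\<^sup>2 + (e * p 1 / (1 - e * p 2))\<^sup>2 = (1 + e * p 2) / (1 - e * p 2)"
    "(d * p 3 / (1 - d * p 4))\<^sup>2 = (1 + d * p 4) / (1 - d * p 4)"
    using u by (simp_all add: power_divide power2_eq_square flip: add_divide_distrib)
  then show "1 + (stereo e d p 0)\<^sup>2 + (stereo e d p 1)\<^sup>2 = 2 / (1 - e * p 2)"
    "1 + (stereo e d p 2)\<^sup>2 = 2 / (1 - d * p 4)"
    using u by (simp_all add: stereo_def add.assoc) (simp_all add: field_simps)
qed

lemma unstereo_in_dom:
  assumes "e \<in> sgns" "d \<in> sgns"
  shows "unstereo e d x \<in> stereo_dom e d"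
proof -
  have e: "e * e = 1" "d * d = 1" "e \<noteq> 0" "d \<noteq> 0" using assms by auto
  have "(2 * u / (1 + u\<^sup>2 + v\<^sup>2))\<^sup>2 + (e * (2 * v / (1 + u\<^sup>2 + v\<^sup>2)))\<^sup>2 + (e * (1 - 2 / (1 + u\<^sup>2 +
      v\<^sup>2)))\<^sup>2 = 1"
    for u v :: real
  proof -
    \<comment> \<open>With w for the reciprocal of the denominator, the claim becomes a polynomial
      identity modulo w(1 + u^2 + v^2) = 1.\<close>
    define w where "w = inverse (1 + u\<^sup>2 + v\<^sup>2)"
    have "w * (1 + u\<^sup>2 + v\<^sup>2) = 1" by (simp add: w_def)
    moreover have "(2 * u * w)\<^sup>2 + (e * (2 * v * w))\<^sup>2 + (e * (1 - 2 * w))\<^sup>2 =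
        4 * w * (w * (1 + u\<^sup>2 + v\<^sup>2)) - 4 * w + 1"
      using assms by (auto simp: power2_eq_square algebra_simps)
    ultimately show ?thesis by (simp add: w_def divide_inverse)
  qed
  moreover have "(d * (2 * u / (1 + u\<^sup>2)))\<^sup>2 + (d * (1 - 2 / (1 + u\<^sup>2)))\<^sup>2 = 1" for u :: real
  proof -
    define w where "w = inverse (1 + u\<^sup>2)"
    have "w * (1 + u\<^sup>2) = 1" by (simp add: w_def)
    moreover have "(d * (2 * u * w))\<^sup>2 + (d * (1 - 2 * w))\<^sup>2 = 4 * w * (w * (1 + u\<^sup>2)) - 4 * w + 1"
      using assms by (auto simp: power2_eq_square algebra_simps)
    ultimately show ?thesis by (simp add: w_def divide_inverse)
  qed
  moreover have "e * (1 - 2 / (1 + u\<^sup>2 + v\<^sup>2)) \<noteq> e" "d * (1 - 2 / (1 + u\<^sup>2)) \<noteq> d" for u v :: real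
    using e by (auto simp: right_diff_distrib)
  ultimately show ?thesis
    by (simp add: stereo_dom_def sphere_circle_def unstereo_def)
qed

lemma unstereo_stereo:
  assumes "p \<in> stereo_dom e d" "e \<in> sgns" "d \<in> sgns"
  shows "unstereo e d (stereo e d p) = p"
proof
  fix i
  note sq = stereo_squares[OF assms]
  have e: "e * (e * c) = c" "d * (d * c) = c" for c
    using assms(2,3) by auto
  have p: "p i = 0" if "i \<ge> 5"
    using assms that by (auto simp: stereo_dom_def sphere_circle_def)
  have "2 * stereo e d p 0 / (2 / (1 - e * p 2)) = p 0" "e * (2 * stereo e d p 1 / (2 / (1 - e * p
      2))) = p 1"
    "d * (2 * stereo e d p 2 / (2 / (1 - d * p 4))) = p 3"
    "e * (1 - 2 / (2 / (1 - e * p 2))) = p 2" "d * (1 - 2 / (2 / (1 - d * p 4))) = p 4"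
    using sq(3,4) e by (simp_all add: stereo_def diff_divide_distrib)
  then show "unstereo e d (stereo e d p) i = p i"
    unfolding unstereo_def sq(1,2) using p by (auto simp: not_le eval_nat_numeral less_Suc_eq)
qed

lemma stereo_unstereo_eq_transition:
  assumes "e \<in> sgns" "d \<in> sgns" "e' \<in> sgns" "d' \<in> sgns" "x \<in> R3"
  shows "stereo e' d' (unstereo e d x) = transition (e = e') (d = d') x"
proof
  fix i
  define q s where "q = 1 + (x 0)\<^sup>2 + (x 1)\<^sup>2" and "s = 1 + (x 2)\<^sup>2"
  have nz: "q \<noteq> 0" "s \<noteq> 0" by (simp_all add: q_def s_def)
  \<comment> \<open>If e' = -e, the denominator 1 - e' p_2 of the second chart equals 1 + (1 - 2/q)
    = 2 - 2/q, and similarly on the circle.\<close>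
  have 1: "2 - 2 / q = 2 * ((x 0)\<^sup>2 + (x 1)\<^sup>2) / q" "2 - 2 / s = 2 * (x 2)\<^sup>2 / s"
    using nz by (simp_all add: divide_simps) (simp_all add: q_def s_def)
  have e: "e' * (e * c) = (if e = e' then c else - c)" "d' * (d * c) = (if d = d' then c else -
      c)" for c
    using assms by auto
  have 2: "1 - e' * unstereo e d x 2 = (if e = e' then 2 / q else 2 * ((x 0)\<^sup>2 + (x 1)\<^sup>2) / q)"
    "1 - d' * unstereo e d x 4 = (if d = d' then 2 / s else 2 * (x 2)\<^sup>2 / s)"
    using 1 by (simp_all add: unstereo_def e q_def s_def)
  have 3: "unstereo e d x 0 = 2 * x 0 / q"
    "e' * unstereo e d x 1 = (if e = e' then 2 * x 1 / q else - (2 * x 1 / q))"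
    "d' * unstereo e d x 3 = (if d = d' then 2 * x 2 / s else - (2 * x 2 / s))"
    by (simp_all add: unstereo_def e q_def s_def)
  have "2 * x 2 / s / (2 * (x 2)\<^sup>2 / s) = 1 / x 2"
    using nz by (simp add: power2_eq_square)
  moreover have "2 * c / q / (2 * ((x 0)\<^sup>2 + (x 1)\<^sup>2) / q) = c / ((x 0)\<^sup>2 + (x 1)\<^sup>2)" for c
    using nz by (simp add: mult_divide_mult_cancel_left del: distrib_left_numeral)
  moreover have "i = 0 \<or> i = 1 \<or> i = 2 \<or> (3::nat) \<le> i" by linarith
  ultimately show "stereo e' d' (unstereo e d x) i = transition (e = e') (d = d') x i"
    unfolding stereo_def transition_def 2 3 using nz by auto
qed

lemma transition_id: "x \<in> R3 \<Longrightarrow> transition True True x = x"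
proof
  fix i assume "x \<in> R3"
  moreover consider "i = 0" | "i = 1" | "i = 2" | "(3::nat) \<le> i" by linarith
  ultimately show "transition True True x i = x i"
    by cases (auto simp: transition_def)
qed

lemma stereo_unstereo:
  "e \<in> sgns \<Longrightarrow> d \<in> sgns \<Longrightarrow> x \<in> R3 \<Longrightarrow> stereo e d (unstereo e d x) = x"
  using stereo_unstereo_eq_transition[of e d e d x] transition_id by simp

lemma stereo_in_R3: "stereo e d p \<in> R3"
  by (simp add: stereo_def)

lemma stereo_image:
  assumes "e \<in> sgns" "d \<in> sgns"
  shows "stereo e d ` stereo_dom e d = R3"
proof (intro equalityI subsetI)
  fix x assume "x \<in> R3"
  then have "x = stereo e d (unstereo e d x)"
    using stereo_unstereo[OF assms] by simp
  then show "x \<in> stereo e d ` stereo_dom e d"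
    using unstereo_in_dom[OF assms] by (rule image_eqI)
qed (use stereo_in_R3 in blast)

lemma inj_on_stereo: "e \<in> sgns \<Longrightarrow> d \<in> sgns \<Longrightarrow> inj_on (stereo e d) (stereo_dom e d)"
  by (rule inj_on_inverseI[of _ "unstereo e d"]) (rule unstereo_stereo)

lemma chart_inv_stereo_chart:
  assumes "e \<in> sgns" "d \<in> sgns" "x \<in> R3"
  shows "chart_inv (stereo_chart e d) x = unstereo e d x"
  using inv_into_f_f[OF inj_on_stereo[OF assms(1,2)] unstereo_in_dom[OF assms(1,2)], of x]
  unfolding chart_inv_def stereo_chart_def fst_conv snd_conv stereo_unstereo[OF assms] .

text \<open>The pole omitted by the opposite chart is the origin of this one.\<close>

lemma in_stereo_dom_iff:
  assumes "e \<in> sgns" "d \<in> sgns" "e' \<in> sgns" "d' \<in> sgns" "x \<in> R3"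
  shows "unstereo e d x \<in> stereo_dom e' d' \<longleftrightarrow> x \<in> overlap (e = e') (d = d')"
proof -
  have M: "unstereo e d x \<in> sphere_circle" "unstereo e d x 2 \<noteq> e" "unstereo e d x 4 \<noteq> d"
    using unstereo_in_dom[OF assms(1,2)] by (auto simp: stereo_dom_def)
  have "e \<noteq> e' \<Longrightarrow> unstereo e d x 2 = e' \<longleftrightarrow> 2 = 2 / (1 + (x 0)\<^sup>2 + (x 1)\<^sup>2)"
    "d \<noteq> d' \<Longrightarrow> unstereo e d x 4 = d' \<longleftrightarrow> 2 = 2 / (1 + (x 2)\<^sup>2)"
    using assms by (auto simp: unstereo_def)
  moreover have *: "2 = 2 / (1 + c) \<longleftrightarrow> c = 0" if "1 + c \<noteq> 0" for c :: real
    using that by (auto simp: field_simps)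
  moreover have "2 = 2 / (1 + (x 0)\<^sup>2 + (x 1)\<^sup>2) \<longleftrightarrow> (x 0)\<^sup>2 + (x 1)\<^sup>2 = 0"
    using *[of "(x 0)\<^sup>2 + (x 1)\<^sup>2"] one_plus_squares_nz(1)[of "x 0" "x 1"]
    unfolding add.assoc by blast
  moreover have "2 = 2 / (1 + (x 2)\<^sup>2) \<longleftrightarrow> x 2 = 0"
    using *[of "(x 2)\<^sup>2"] by simp
  ultimately have "e \<noteq> e' \<Longrightarrow> unstereo e d x 2 = e' \<longleftrightarrow> (x 0)\<^sup>2 + (x 1)\<^sup>2 = 0"
    "d \<noteq> d' \<Longrightarrow> unstereo e d x 4 = d' \<longleftrightarrow> x 2 = 0"
    by simp_all
  then show ?thesis
    using M assms(5) by (auto simp: stereo_dom_def overlap_def)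
qed

lemma stereo_image_overlap:
  assumes "e \<in> sgns" "d \<in> sgns" "e' \<in> sgns" "d' \<in> sgns"
  shows "stereo e d ` (stereo_dom e d \<inter> stereo_dom e' d') = overlap (e = e') (d = d')"
proof (intro equalityI subsetI)
  fix x assume "x \<in> stereo e d ` (stereo_dom e d \<inter> stereo_dom e' d')"
  then obtain p where p: "p \<in> stereo_dom e d" "p \<in> stereo_dom e' d'" "x = stereo e d p" by blast
  then show "x \<in> overlap (e = e') (d = d')"
    using in_stereo_dom_iff[OF assms stereo_in_R3[of e d p]] unstereo_stereo[OF p(1) assms(1,2)]
        by simp
next
  fix x assume x: "x \<in> overlap (e = e') (d = d')"
  then have "x \<in> R3" by (auto simp: overlap_def)
  then show "x \<in> stereo e d ` (stereo_dom e d \<inter> stereo_dom e' d')"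
    using in_stereo_dom_iff[OF assms, of x] x unstereo_in_dom[OF assms(1,2)]
    by (intro image_eqI[of _ _ "unstereo e d x"] IntI) (simp_all only: stereo_unstereo[OF
        assms(1,2)])
qed

section \<open>The atlas and the compactness of the manifold\<close>

lemma continuous_on_component [continuous_intros]:
  "continuous_on S (\<lambda>x::nat \<Rightarrow> real. x i)"
  by (rule continuous_on_product_then_coordinatewise) (rule continuous_on_id)

lemma continuous_on_stereo:
  assumes "e \<in> sgns" "d \<in> sgns"
  shows "continuous_on (stereo_dom e d) (stereo e d)"
proof (rule continuous_on_coordinatewise_then_product)
  fix i
  have "1 - e * p 2 \<noteq> 0" "1 - d * p 4 \<noteq> 0" if "p \<in> stereo_dom e d" for p
    using stereo_squares[OF that assms] by auto
  then show "continuous_on (stereo_dom e d) (\<lambda>p. stereo e d p i)"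
    by (cases "i = 0"; cases "i = 1"; cases "i = 2") (auto simp: stereo_def intro!:
        continuous_intros)
qed

lemma continuous_on_unstereo: "continuous_on S (unstereo e d)"
proof (rule continuous_on_coordinatewise_then_product)
  show "continuous_on S (\<lambda>x. unstereo e d x i)" for i
    by (cases "i = 0"; cases "i = 1"; cases "i = 2"; cases "i = 3"; cases "i = 4")
      (auto simp: unstereo_def intro!: continuous_intros)
qed

lemma openin_R3: "openin (Euclidean_space 3) R3"
  by (metis openin_topspace topspace_Euclidean_space)

lemma openin_overlap: "openin (Euclidean_space 3) (overlap a b)"
proof -
  have "open {x::nat \<Rightarrow> real. (a \<or> (x 0)\<^sup>2 + (x 1)\<^sup>2 \<noteq> 0) \<and> (b \<or> x 2 \<noteq> 0)}"
    by (intro open_Collect_conj open_Collect_disj open_Collect_neq continuous_intros) auto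
  then show ?thesis
    unfolding Euclidean_space_eq openin_open overlap_def by (auto simp: Int_def)
qed

lemma is_chart_stereo_chart:
  assumes "e \<in> sgns" "d \<in> sgns"
  shows "is_chart 3 (top_of_set sphere_circle) (stereo_chart e d)"
proof -
  have "open {p::nat \<Rightarrow> real. p 2 \<noteq> e \<and> p 4 \<noteq> d}"
    by (intro open_Collect_conj open_Collect_neq continuous_intros)
  then have 1: "openin (top_of_set sphere_circle) (stereo_dom e d)"
    unfolding openin_open stereo_dom_def by (auto simp: Int_def)
  have 2: "subtopology (top_of_set sphere_circle) (stereo_dom e d) = top_of_set (stereo_dom e d)"
    by (simp add: subtopology_subtopology stereo_dom_def Int_def Collect_conj_eq[symmetric] conj_ac)
  have "homeomorphic_maps (top_of_set (stereo_dom e d)) (top_of_set R3) (stereo e d) (unstereo e d)"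
    using continuous_on_stereo[OF assms] continuous_on_unstereo[of R3 e d] stereo_in_R3
      unstereo_in_dom[OF assms] stereo_unstereo[OF assms] unstereo_stereo[OF _ assms]
    by (auto simp: homeomorphic_maps_def)
  then show ?thesis
    using 1 2 openin_R3 homeomorphic_maps_map stereo_image[OF assms]
    by (simp add: is_chart_def stereo_chart_def subtopology_Euclidean_space) blast
qed

lemma rational_on_transition: "rational_on J (overlap a b) (\<lambda>t x. transition a b x i)"
  by (cases "i = 0"; cases "i = 1"; cases "i = 2"; cases a; cases b)
    (auto simp: transition_def overlap_def intro!: rational_on_intros)

text \<open>Projecting from the pole in the opposite hemisphere makes 1 - \<open>e * p 2\<close> at
  least 1, and then |z| \<le> 1 by \<open>stereo_squares\<close>; likewise on the circle. This
  serves both compactness and the uniform constant in the volume bound.\<close>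

lemma stereo_centre:
  assumes "p \<in> sphere_circle"
  obtains e d where "e \<in> sgns" "d \<in> sgns" "p \<in> stereo_dom e d"
    "(stereo e d p 0)\<^sup>2 + (stereo e d p 1)\<^sup>2 \<le> 1" "(stereo e d p 2)\<^sup>2 \<le> 1"
proof -
  define e d :: real where "e = (if p 2 \<le> 0 then 1 else -1)" and "d = (if p 4 \<le> 0 then 1 else -1)"
  have s: "e \<in> sgns" "d \<in> sgns" by (auto simp: e_def d_def)
  have le: "1 - e * p 2 \<ge> 1" "1 - d * p 4 \<ge> 1" by (auto simp: e_def d_def)
  then have p: "p \<in> stereo_dom e d"
    using assms by (auto simp: stereo_dom_def e_def d_def)
  have "2 / (1 - e * p 2) \<le> 2" "2 / (1 - d * p 4) \<le> 2"
    using le by (simp_all add: divide_simps)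
  then show ?thesis
    using that[OF s p] stereo_squares[OF p s] by linarith
qed

text \<open>A cube rather than a disc times an interval, since it is a product of compact intervals,
  with the factor {0} at all indices from 3 on, to which Tychonoff's theorem applies.\<close>

definition unit_cube :: "(nat \<Rightarrow> real) set" where
  "unit_cube = {x \<in> R3. \<forall>i<3. \<bar>x i\<bar> \<le> 1}"

lemma sphere_circle_covered:
  assumes "p \<in> sphere_circle"
  obtains e d x where "e \<in> sgns" "d \<in> sgns" "x \<in> unit_cube" "p = unstereo e d x"
proof -
  obtain e d where s: "e \<in> sgns" "d \<in> sgns" and p: "p \<in> stereo_dom e d"
    and le: "(stereo e d p 0)\<^sup>2 + (stereo e d p 1)\<^sup>2 \<le> 1" "(stereo e d p 2)\<^sup>2 \<le> 1"
    using stereo_centre[OF assms] by blast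
  have "\<bar>stereo e d p i\<bar> \<le> 1" if "i < 3" for i
  proof -
    have "u\<^sup>2 \<le> 1 \<and> v\<^sup>2 \<le> 1" if "u\<^sup>2 + v\<^sup>2 \<le> 1" for u v :: real
      using that zero_le_power2[of u] zero_le_power2[of v] by linarith
    moreover have "i = 0 \<or> i = 1 \<or> i = 2" using that by linarith
    ultimately have "(stereo e d p i)\<^sup>2 \<le> 1"
      using le by blast
    then show ?thesis by (simp add: abs_square_le_1)
  qed
  then have "stereo e d p \<in> unit_cube"
    using stereo_in_R3 by (auto simp: unit_cube_def)
  then show ?thesis
    using that[OF s _ unstereo_stereo[OF p s, symmetric]] by blast
qed

lemma compact_unit_cube: "compact unit_cube"
proof -
  have "x \<in> unit_cube \<longleftrightarrow> (\<forall>i. x i \<in> (if i < 3 then {-1..1} else {0}))" for x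
    unfolding unit_cube_def by (auto simp: abs_le_iff minus_le_iff not_less)
  then have "unit_cube = PiE UNIV (\<lambda>i. if i < 3 then {-1..1} else {0})"
    by (auto simp: PiE_UNIV_domain)
  moreover have "compactin (product_topology (\<lambda>i::nat. euclideanreal) UNIV) (PiE UNIV (\<lambda>i. if i <
      3 then {-1..1} else {0}))"
    by (subst compactin_PiE) auto
  ultimately show ?thesis
    by (simp add: euclidean_product_topology)
qed

text \<open>The manifold is the union of four continuous images of the unit cube.\<close>

lemma compact_sphere_circle: "compact sphere_circle"
proof -
  have "p \<in> (\<Union>e\<in>sgns. \<Union>d\<in>sgns. unstereo e d ` unit_cube)" if p: "p \<in> sphere_circle" for p
    by (rule sphere_circle_covered[OF p]) (intro UN_I image_eqI)
  moreover have "unstereo e d x \<in> sphere_circle" if "e \<in> sgns" "d \<in> sgns" for e d x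
    using unstereo_in_dom[OF that] by (simp add: stereo_dom_def)
  ultimately have "sphere_circle = (\<Union>e\<in>sgns. \<Union>d\<in>sgns. unstereo e d ` unit_cube)"
    by (intro equalityI subsetI) (assumption | elim UN_E imageE, simp)+
  moreover have "compact (\<Union>e\<in>sgns. \<Union>d\<in>sgns. unstereo e d ` unit_cube)"
    by (intro compact_UN compact_continuous_image continuous_on_unstereo compact_unit_cube) auto
  ultimately show ?thesis by simp
qed

lemma stereo_atlasE:
  assumes "c \<in> stereo_atlas"
  obtains e d where "e \<in> sgns" "d \<in> sgns" "c = stereo_chart e d"
  using assms unfolding stereo_atlas_def by blast

lemma ball_stereo_atlas:
  "(\<forall>c\<in>stereo_atlas. P c) \<longleftrightarrow> (\<forall>e\<in>sgns. \<forall>d\<in>sgns. P (stereo_chart e d))"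
  by (auto simp: stereo_atlas_def)

lemma stereo_chart_in_atlas: "e \<in> sgns \<Longrightarrow> d \<in> sgns \<Longrightarrow> stereo_chart e d \<in> stereo_atlas"
  unfolding stereo_atlas_def by blast

lemma stereo_chart_simps [simp]:
  "fst (stereo_chart e d) = stereo_dom e d" "snd (stereo_chart e d) = stereo e d"
  by (simp_all add: stereo_chart_def)

lemma chart_image_stereo: "c \<in> stereo_atlas \<Longrightarrow> chart_image c = R3"
  by (elim stereo_atlasE) (use stereo_image in auto)

lemma closed_manifold_sphere_circle: "closed_manifold 3 (top_of_set sphere_circle) stereo_atlas"
  unfolding closed_manifold_def
proof (intro conjI)
  show "Hausdorff_space (top_of_set sphere_circle)"
    by (simp add: Hausdorff_space_subtopology)
  show "second_countable (top_of_set sphere_circle)"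
  proof (rule second_countable_subtopology)
    \<comment> \<open>The type class states that open sets are unions of basic sets, while the
      definition for abstract topologies asks for a basic set around each point.\<close>
    obtain B :: "(nat \<Rightarrow> real) set set" where B: "countable B" "\<And>C. C \<in> B \<Longrightarrow> open C"
      "\<And>S. open S \<Longrightarrow> \<exists>U. U \<subseteq> B \<and> S = \<Union>U"
      using univ_second_countable by blast
    have "\<exists>V\<in>B. x \<in> V \<and> V \<subseteq> S" if "open S" "x \<in> S" for S x
      using B(3)[OF that(1)] that(2) by blast
    then show "second_countable (euclidean :: (nat \<Rightarrow> real) topology)"
      unfolding second_countable_def open_openin[symmetric] using B(1,2) by blast
  qed
  show "compact_space (top_of_set sphere_circle)"
    using compact_sphere_circle by (simp add: compact_space_subtopology)
  have cover: "(\<Union>c\<in>stereo_atlas. fst c) = sphere_circle"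
    unfolding stereo_atlas_def using stereo_centre by (auto simp: stereo_dom_def)
  have "smooth_on_open 3 (stereo e d ` (stereo_dom e d \<inter> stereo_dom e' d'))
      (\<lambda>x. stereo e' d' (chart_inv (stereo_chart e d) x) i)"
    if s: "e \<in> sgns" "d \<in> sgns" "e' \<in> sgns" "d' \<in> sgns" for e d e' d' i
    unfolding stereo_image_overlap[OF s]
    by (rule smooth_on_open_rational[OF openin_overlap rational_on_transition])
      (auto simp: chart_inv_stereo_chart[OF s(1,2)] stereo_unstereo_eq_transition[OF s] overlap_def)
  then show "smooth_atlas 3 (top_of_set sphere_circle) stereo_atlas"
    unfolding smooth_atlas_def ball_stereo_atlas using is_chart_stereo_chart cover by simp
qed


section \<open>Curvature of the metrics\<close>

lemma less_3_cases: "i < 3 \<Longrightarrow> i = 0 \<or> i = Suc 0 \<or> i = (2::nat)"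
  by linarith

lemma sum_less_3: "(\<Sum>i<(3::nat). f i) = f 0 + f (Suc 0) + (f 2 :: 'a :: comm_monoid_add)"
  by (simp add: eval_nat_numeral)

lemma multi_indices_0: "multi_indices n 0 = {[]}"
  by (auto simp: multi_indices_def)

lemma multi_indices_Suc: "multi_indices n (Suc k) = (\<lambda>(i, is). i # is) ` ({..<n} \<times> multi_indices n
    k)"
  by (auto simp: multi_indices_def length_Suc_conv image_iff)

lemma finite_multi_indices: "finite (multi_indices n k)"
  by (induction k) (simp_all add: multi_indices_0 multi_indices_Suc)

lemma sum_multi_indices_Suc:
  "(\<Sum>is\<in>multi_indices n (Suc k). f is) = (\<Sum>i<n. \<Sum>is\<in>multi_indices n k. f (i # is))"
proof -
  have "(\<Sum>is\<in>multi_indices n (Suc k). f is) = (\<Sum>(i, is)\<in>{..<n} \<times> multi_indices n k. f (i # is))"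
    unfolding multi_indices_Suc by (subst sum.reindex) (auto simp: inj_on_def case_prod_unfold)
  then show ?thesis by (simp add: sum.cartesian_product)
qed

lemma sum_multi_indices_2: "(\<Sum>is\<in>multi_indices n 2. f is) = (\<Sum>i<n. \<Sum>j<n. f [i, j])"
  by (simp add: numeral_2_eq_2 sum_multi_indices_Suc multi_indices_0)

lemma sum_multi_indices_3: "(\<Sum>is\<in>multi_indices n 3. f is) = (\<Sum>i<n. \<Sum>j<n. \<Sum>k<n. f [i, j, k])"
  by (simp add: numeral_3_eq_3 sum_multi_indices_Suc multi_indices_0)

lemma multi_indices_2E:
  assumes "is \<in> multi_indices n 2"
  obtains i j where "is = [i, j]" "i < n" "j < n"
  using assms by (auto simp: multi_indices_def numeral_2_eq_2 length_Suc_conv)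

lemma multi_indices_3E:
  assumes "is \<in> multi_indices n 3"
  obtains i j k where "is = [i, j, k]" "i < n" "j < n" "k < n"
  using assms by (auto simp: multi_indices_def numeral_3_eq_3 length_Suc_conv)

lemma multi_indices_4E:
  assumes "is \<in> multi_indices n 4"
  obtains i j k l where "is = [i, j, k, l]" "i < n" "j < n" "k < n" "l < n"
  using assms by (auto simp: multi_indices_def eval_nat_numeral length_Suc_conv)

text \<open>\<open>inv_metric\<close> is a definite description, so the diagonal matrix of
  reciprocals must also be the only right inverse. Uniqueness holds because it is a left inverse as
  well.\<close>

lemma inv_metric_diagonal:
  assumes G: "\<And>i j. i < n \<Longrightarrow> j < n \<Longrightarrow> G [i, j] x = (if i = j then D i else 0)"
    and D: "\<And>i. i < n \<Longrightarrow> D i \<noteq> 0" and ij: "i < n" "j < n"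
  shows "inv_metric n G i j x = (if i = j then 1 / D i else 0)"
proof -
  define A where "A = metric_mat n G x"
  define B where "B = Matrix.mat n n (\<lambda>(i, j). if i = j then 1 / D i else 0)"
  have A: "A \<in> carrier_mat n n" and B: "B \<in> carrier_mat n n"
    by (simp_all add: A_def metric_mat_def B_def)
  have AB: "A * B = 1\<^sub>m n"
  proof (rule eq_matI)
    fix i j assume "i < dim_row (1\<^sub>m n :: real mat)" "j < dim_col (1\<^sub>m n :: real mat)"
    then have i: "i < n" "j < n" by auto
    have "(A * B) $$ (i, j) = (\<Sum>k<n. (if i = k then D i else 0) * (if k = j then 1 / D k else 0))"
      using i G by (simp add: A_def metric_mat_def B_def scalar_prod_def atLeast0LessThan)
    also have "\<dots> = (\<Sum>k<n. if k = i then (if i = j then 1 else 0) else 0)"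
      using D by (intro sum.cong) auto
    also have "\<dots> = 1\<^sub>m n $$ (i, j)" using i by simp
    finally show "(A * B) $$ (i, j) = 1\<^sub>m n $$ (i, j)" .
  qed (use A B in auto)
  have uniq: "B' = B" if B': "B' \<in> carrier_mat n n" "A * B' = 1\<^sub>m n" for B'
  proof -
    have "B * A = 1\<^sub>m n" using mat_mult_left_right_inverse[OF A B AB] .
    have "B' = (B * A) * B'" using \<open>B * A = 1\<^sub>m n\<close> B' by simp
    also have "\<dots> = B * (A * B')" by (rule assoc_mult_mat[OF B A B'(1)])
    finally show ?thesis using B' B by simp
  qed
  have dim: "dim_row A = n" using A by simp
  have "(THE B. B \<in> carrier_mat n n \<and> inverts_mat A B) = B"
    by (rule the_equality) (simp_all only: inverts_mat_def dim AB B simp_thms uniq)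
  then show ?thesis
    using ij unfolding inv_metric_def A_def by (simp add: B_def)
qed

section \<open>The metric in coordinates, its connection and its curvature\<close>

definition sphere_density :: "(nat \<Rightarrow> real) \<Rightarrow> real" where
  "sphere_density x = 4 / (1 + (x 0)\<^sup>2 + (x 1)\<^sup>2)\<^sup>2"

definition circle_density :: "(nat \<Rightarrow> real) \<Rightarrow> real" where
  "circle_density x = 2 / (1 + (x 2)\<^sup>2)"

text \<open>The round metrics are \<open>sphere_density\<close> times |dz|^2 and the square of
  \<open>circle_density\<close> times du^2. Only the second is squared: in dimension two the
  conformal factor is already the area density, so both functions are volume densities.\<close>

definition metric_diag :: "real \<Rightarrow> nat \<Rightarrow> (nat \<Rightarrow> real) \<Rightarrow> real" where
  "metric_diag t i x = (if i < 2 then (1 - t) * sphere_density x else (circle_density x)\<^sup>2 / (1 -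
      t))"

definition flow_metric :: "real \<Rightarrow> tensor" where
  "flow_metric t is x = (if is ! 0 = is ! 1 then metric_diag t (is ! 0) x else 0)"

definition levi_civita :: "nat list \<Rightarrow> real" where
  "levi_civita is =
     (if is \<in> {[0, 1, 2], [1, 2, 0], [2, 0, 1]} then 1
      else if is \<in> {[0, 2, 1], [2, 1, 0], [1, 0, 2]} then -1 else 0)"

definition torsion_form :: tensor where
  "torsion_form is x = levi_civita is * (sphere_density x * circle_density x)"

text \<open>\<open>log_deriv i j\<close> is $\frac12\partial_i\log g_{jj}$.\<close>

definition log_deriv :: "nat \<Rightarrow> nat \<Rightarrow> (nat \<Rightarrow> real) \<Rightarrow> real" where
  "log_deriv i j x =
     (if i < 2 \<and> j < 2 then - 2 * x i / (1 + (x 0)\<^sup>2 + (x 1)\<^sup>2)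
      else if i = 2 \<and> j = 2 then - 2 * x 2 / (1 + (x 2)\<^sup>2) else 0)"

lemma sphere_density_pos: "0 < sphere_density x"
  by (simp add: sphere_density_def)

lemma circle_density_pos: "0 < circle_density x"
  by (simp add: circle_density_def one_plus_squares_pos)

lemma metric_diag_pos: "t < 1 \<Longrightarrow> 0 < metric_diag t i x"
  unfolding metric_diag_def
  by (auto intro!: mult_pos_pos divide_pos_pos zero_less_power sphere_density_pos
      circle_density_pos)

lemma metric_diag_nz: "t < 1 \<Longrightarrow> metric_diag t i x \<noteq> 0"
  using metric_diag_pos[of t i x] by auto

lemma inv_flow_metric:
  assumes "t < 1" "i < 3" "j < 3"
  shows "inv_metric 3 (flow_metric t) i j x = (if i = j then 1 / metric_diag t i x else 0)"
  by (rule inv_metric_diagonal) (use assms in \<open>auto simp: flow_metric_def metric_diag_nz\<close>)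

lemma has_derivative_sphere_density:
  assumes "i < 3"
  shows "((\<lambda>s. sphere_density (x(i := s))) has_real_derivative
      (if i < 2 then 2 * log_deriv i 0 x * sphere_density x else 0)) (at (x i))"
proof -
  \<comment> \<open>One formula, with c the square of the other coordinate, serves both directions
    on the sphere.\<close>
  have "((\<lambda>s. 4 / (1 + s\<^sup>2 + c)\<^sup>2) has_real_derivative 2 * (- 2 * u / (1 + u\<^sup>2 + c)) * (4 / (1 +
      u\<^sup>2 + c)\<^sup>2)) (at u)"
    if "1 + u\<^sup>2 + c \<noteq> 0" for c u :: real
  proof -
    have "((\<lambda>w. 4 / w\<^sup>2) has_real_derivative - 8 / w ^ 3) (at w)" if "w \<noteq> 0" for w :: real
      using that by (auto intro!: derivative_eq_intros simp: field_simps eval_nat_numeral)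
    moreover have "((\<lambda>s. 1 + s\<^sup>2 + c) has_real_derivative 2 * u) (at u)"
      by (auto intro!: derivative_eq_intros)
    ultimately have "((\<lambda>s. 4 / (1 + s\<^sup>2 + c)\<^sup>2) has_real_derivative - 8 / (1 + u\<^sup>2 + c) ^ 3 * (2 *
        u)) (at u)"
      using that by (intro DERIV_chain2[of "\<lambda>w. 4 / w\<^sup>2"])
    moreover have "- 8 / w ^ 3 * (2 * u) = 2 * (- 2 * u / w) * (4 / w\<^sup>2)" if "w \<noteq> 0" for w
      using that by (simp add: field_simps eval_nat_numeral)
    ultimately show ?thesis using that by metis
  qed
  from this[of "x 0" "(x 1)\<^sup>2"] this[of "x 1" "(x 0)\<^sup>2"] show ?thesis
    using less_3_cases[OF assms] by (auto simp: sphere_density_def log_deriv_def add_ac)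
qed

lemma has_derivative_circle_density:
  assumes "i < 3"
  shows "((\<lambda>s. circle_density (x(i := s))) has_real_derivative
      (if i = 2 then log_deriv 2 2 x * circle_density x else 0)) (at (x i))"
proof -
  have "((\<lambda>s. 2 / (1 + s\<^sup>2)) has_real_derivative (- 2 * u / (1 + u\<^sup>2)) * (2 / (1 + u\<^sup>2))) (at u)"
    for u :: real
    by (auto intro!: derivative_eq_intros simp: divide_simps)
  then show ?thesis
    using less_3_cases[OF assms] by (auto simp: circle_density_def log_deriv_def)
qed

lemma coord_partial_flow_metric:
  assumes "x \<in> R3" "i < 3" "j < 3" "k < 3"
  shows "coord_partial i (flow_metric t [j, k]) x = (if j = k then 2 * log_deriv i j x *
      metric_diag t j x else 0)"
proof (rule coord_partial_eqI(2)[OF openin_R3 assms(1,2) refl])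
  have "((\<lambda>s. metric_diag t j (x(i := s))) has_real_derivative 2 * log_deriv i j x * metric_diag t
      j x) (at (x i))"
  proof (cases "j < 2")
    case True
    have "((\<lambda>s. (1 - t) * sphere_density (x(i := s))) has_real_derivative
      (1 - t) * (if i < 2 then 2 * log_deriv i 0 x * sphere_density x else 0)) (at (x i))"
      by (rule DERIV_cmult[OF has_derivative_sphere_density[OF assms(2)]])
    moreover have "(1 - t) * (if i < 2 then 2 * log_deriv i 0 x * sphere_density x else 0) = 2 *
        log_deriv i j x * metric_diag t j x"
      using True by (auto simp: log_deriv_def metric_diag_def)
    ultimately show ?thesis using True by (simp only: metric_diag_def if_True)
  next
    case False
    have "((\<lambda>s. circle_density (x(i := s)) * circle_density (x(i := s)) / (1 - t))
        has_real_derivative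
      ((if i = 2 then log_deriv 2 2 x * circle_density x else 0) * circle_density x
        + (if i = 2 then log_deriv 2 2 x * circle_density x else 0) * circle_density x) / (1 - t))
            (at (x i))"
      by (rule DERIV_cong[OF DERIV_cdivide[OF DERIV_mult[OF has_derivative_circle_density[OF
          assms(2)] has_derivative_circle_density[OF assms(2)]]]])
        (simp only: fun_upd_triv)
    moreover have "((if i = 2 then log_deriv 2 2 x * circle_density x else 0) * circle_density x
        + (if i = 2 then log_deriv 2 2 x * circle_density x else 0) * circle_density x) / (1 - t)
            = 2 * log_deriv i j x * metric_diag t j x"
      using False assms(3) less_3_cases[OF assms(2)] by (auto simp: log_deriv_def metric_diag_def
          power2_eq_square algebra_simps)
    ultimately show ?thesis using False by (simp only: metric_diag_def if_False power2_eq_square)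
  qed
  then show "((\<lambda>s. flow_metric t [j, k] (x(i := s))) has_real_derivative
      (if j = k then 2 * log_deriv i j x * metric_diag t j x else 0)) (at (x i))"
    by (cases "j = k") (simp_all add: flow_metric_def)
qed

text \<open>For a diagonal metric the last term of \<Gamma>^k_ij carries a quotient g_ii/g_kk. It is
  omitted here because \<open>log_deriv k i\<close> vanishes unless i and k belong to the same
  factor, where g_ii = g_kk. So the connection does not depend on t.\<close>

definition flow_christoffel :: "nat \<Rightarrow> nat \<Rightarrow> nat \<Rightarrow> (nat \<Rightarrow> real) \<Rightarrow> real" where
  "flow_christoffel k i j x =
     (if j = k then log_deriv i j x else 0) + (if i = k then log_deriv j i x else 0)
       - (if i = j then log_deriv k i x else 0)"

lemma christoffel_flow_metric:
  assumes "t < 1" "x \<in> R3" "i < 3" "j < 3" "k < 3"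
  shows "christoffel 3 (flow_metric t) k i j x = flow_christoffel k i j x"
proof -
  have "christoffel 3 (flow_metric t) k i j x = (1 / 2) * (\<Sum>l<3. if l = k then 1 / metric_diag t k
      x *
      ((if j = k then 2 * log_deriv i j x * metric_diag t j x else 0)
        + (if i = k then 2 * log_deriv j i x * metric_diag t i x else 0)
        - (if i = j then 2 * log_deriv k i x * metric_diag t i x else 0)) else 0)"
    unfolding christoffel_def using assms
    by (intro arg_cong[of _ _ "(*) (1 / 2)"] sum.cong) (auto simp: inv_flow_metric
        coord_partial_flow_metric)
  also have "\<dots> = (1 / 2) * (1 / metric_diag t k x *
      ((if j = k then 2 * log_deriv i j x * metric_diag t j x else 0)
        + (if i = k then 2 * log_deriv j i x * metric_diag t i x else 0)
        - (if i = j then 2 * log_deriv k i x * metric_diag t i x else 0)))"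
    using assms by simp
  also have "\<dots> = flow_christoffel k i j x"
  proof -
    have "log_deriv k i x * metric_diag t i x = log_deriv k i x * metric_diag t k x"
      by (auto simp: log_deriv_def metric_diag_def)
    then show ?thesis
      using metric_diag_nz[OF assms(1), of k x]
      by (cases "j = k"; cases "i = k"; cases "i = j") (auto simp: flow_christoffel_def field_simps)
  qed
  finally show ?thesis .
qed

text \<open>The m-th partial derivative of \<open>log_deriv i j\<close>, written through
  \<open>log_deriv\<close> itself, so that the curvature becomes polynomial in the coordinates and
  1/(1 + |z|^2).\<close>

definition log_deriv2 :: "nat \<Rightarrow> nat \<Rightarrow> nat \<Rightarrow> (nat \<Rightarrow> real) \<Rightarrow> real" where
  "log_deriv2 m i j x =
     (if i < 2 \<and> j < 2 then
        (if m < 2 then log_deriv m 0 x * log_deriv i 0 x - (if m = i then 2 / (1 + (x 0)\<^sup>2 + (x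
            1)\<^sup>2) else 0) else 0)
      else if i = 2 \<and> j = 2 \<and> m = 2 then (log_deriv 2 2 x)\<^sup>2 - 2 / (1 + (x 2)\<^sup>2) else 0)"

lemma has_derivative_log_deriv:
  assumes "m < 3" "i < 3" "j < 3"
  shows "((\<lambda>s. log_deriv i j (x(m := s))) has_real_derivative log_deriv2 m i j x) (at (x m))"
proof -
  have 1: "((\<lambda>s. - 2 * s / (1 + s\<^sup>2 + c)) has_real_derivative
       (- 2 * u / (1 + u\<^sup>2 + c)) * (- 2 * u / (1 + u\<^sup>2 + c)) - 2 / (1 + u\<^sup>2 + c)) (at u)"
    if "1 + u\<^sup>2 + c \<noteq> 0" for c u :: real
    using that by (auto intro!: derivative_eq_intros simp: divide_simps)
  have 2: "((\<lambda>s. - 2 * v / (1 + s\<^sup>2 + c)) has_real_derivative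
       (- 2 * u / (1 + u\<^sup>2 + c)) * (- 2 * v / (1 + u\<^sup>2 + c))) (at u)"
    if "1 + u\<^sup>2 + c \<noteq> 0" for c u v :: real
    using that by (auto intro!: derivative_eq_intros simp: divide_simps)
  have nz: "1 + (x 0)\<^sup>2 + (x 1)\<^sup>2 \<noteq> 0" "1 + (x 1)\<^sup>2 + (x 0)\<^sup>2 \<noteq> 0" "1 + (x 2)\<^sup>2 + 0 \<noteq> 0"
    by simp_all
  have "((\<lambda>s. log_deriv 0 0 (x(0 := s))) has_real_derivative log_deriv2 0 0 0 x) (at (x 0))"
    using 1[OF nz(1)] by (simp add: log_deriv_def log_deriv2_def)
  moreover have "((\<lambda>s. log_deriv 1 0 (x(0 := s))) has_real_derivative log_deriv2 0 1 0 x) (at (x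
      0))"
    using 2[OF nz(1), of "x 1"] by (simp add: log_deriv_def log_deriv2_def)
  moreover have "((\<lambda>s. log_deriv 0 0 (x(1 := s))) has_real_derivative log_deriv2 1 0 0 x) (at (x
      1))"
    using 2[OF nz(2), of "x 0"] by (simp add: log_deriv_def log_deriv2_def add_ac)
  moreover have "((\<lambda>s. log_deriv 1 0 (x(1 := s))) has_real_derivative log_deriv2 1 1 0 x) (at (x
      1))"
    using 1[OF nz(2)] by (simp add: log_deriv_def log_deriv2_def add_ac)
  moreover have "((\<lambda>s. log_deriv 2 2 (x(2 := s))) has_real_derivative log_deriv2 2 2 2 x) (at (x
      2))"
    using 1[OF nz(3)] by (simp add: log_deriv_def log_deriv2_def power2_eq_square)
  \<comment> \<open>The index j matters only through the factor it belongs to, so the five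
    derivatives above and the vanishing cases below cover all triples of indices.\<close>
  moreover have "log_deriv i j = log_deriv i 0" "log_deriv2 m i j = log_deriv2 m i 0" if "j < 2"
    using that by (simp_all add: log_deriv_def log_deriv2_def fun_eq_iff)
  moreover have "log_deriv i 0 (x(2 := s)) = log_deriv i 0 x" if "i < 2" for s
    using that by (simp add: log_deriv_def)
  moreover have "log_deriv 2 0 = (\<lambda>x. 0)" "log_deriv2 m 2 0 = (\<lambda>x. 0)" "i < 2 \<Longrightarrow> log_deriv i 2 =
      (\<lambda>x. 0)"
    "i < 2 \<Longrightarrow> log_deriv2 m i 2 = (\<lambda>x. 0)" "i < 2 \<Longrightarrow> log_deriv2 2 i 0 = (\<lambda>x. 0)"
    "m < 2 \<Longrightarrow> log_deriv2 m 2 2 = (\<lambda>x. 0)" "m < 2 \<Longrightarrow> log_deriv 2 2 (x(m := s)) = log_deriv 2 2 x" for s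
    by (simp_all add: log_deriv_def log_deriv2_def fun_eq_iff)
  moreover have "m = 0 \<or> m = 1 \<or> m = 2" "i = 0 \<or> i = 1 \<or> i = 2" "j < 2 \<or> j = 2"
    using assms by linarith+
  ultimately show ?thesis
    by (elim disjE; hypsubst) (simp_all only: DERIV_const zero_less_numeral one_less_numeral_iff
        semiring_norm)
qed

lemma coord_partial_christoffel:
  assumes "t < 1" "x \<in> R3" "m < 3" "i < 3" "j < 3" "k < 3"
  shows "coord_partial m (christoffel 3 (flow_metric t) k i j) x =
     (if j = k then log_deriv2 m i j x else 0) + (if i = k then log_deriv2 m j i x else 0)
       - (if i = j then log_deriv2 m k i x else 0)"
proof (rule coord_partial_eqI(2)[OF openin_R3 assms(2,3)])
  show "christoffel 3 (flow_metric t) k i j y = flow_christoffel k i j y" if "y \<in> R3" for y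
    using christoffel_flow_metric[OF assms(1) that assms(4-6)] .
  show "((\<lambda>s. flow_christoffel k i j (x(m := s))) has_real_derivative
     (if j = k then log_deriv2 m i j x else 0) + (if i = k then log_deriv2 m j i x else 0)
       - (if i = j then log_deriv2 m k i x else 0)) (at (x m))"
    unfolding flow_christoffel_def
    using has_derivative_log_deriv[OF assms(3), where x = x] assms
    by (intro DERIV_diff DERIV_add) auto
qed

text \<open>The circle is flat, the sphere has constant curvature, and the curvature with one upper
  index is invariant under scaling of the factors. This is why t does not occur on the
  right.\<close>

lemma riemann_flow_metric:
  assumes "t < 1" "x \<in> R3" "l < 3" "i < 3" "j < 3" "k < 3"
  shows "riemann 3 (flow_metric t) l i j k x =
     (if i < 2 \<and> j < 2 \<and> k < 2 \<and> l < 2 then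
        sphere_density x * ((if j = k \<and> i = l then 1 else 0) - (if i = k \<and> j = l then 1 else 0))
            else 0)"
proof -
  define w where "w = 1 / (1 + (x 0)\<^sup>2 + (x 1)\<^sup>2)"
  have w: "log_deriv 0 0 x = - 2 * x 0 * w" "log_deriv 0 1 x = - 2 * x 0 * w"
    "log_deriv 1 0 x = - 2 * x 1 * w" "log_deriv 1 1 x = - 2 * x 1 * w"
    "2 / (1 + (x 0)\<^sup>2 + (x 1)\<^sup>2) = 2 * w" "sphere_density x = 4 * w * w"
    by (simp_all add: w_def log_deriv_def sphere_density_def power2_eq_square)
  have "w * (1 + (x 0)\<^sup>2 + (x 1)\<^sup>2) = 1" by (simp add: w_def)
  then have "w * w * (1 + (x 0)\<^sup>2 + (x 1)\<^sup>2) = w" by (simp only: mult.assoc)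
  \<comment> \<open>The relation w(1 + |z|^2) = 1, in the form in which w^2 |z|^2 shows up in the 81
    components.\<close>
  then have ww: "w * (w * (x 0 * x 0)) + w * (w * (x 1 * x 1)) = w - w * w" 
    by (simp add: algebra_simps power2_eq_square)
  have *: "log_deriv i 2 x = 0" "log_deriv 2 i x = 0" if "i < 2" for i
    using that by (auto simp: log_deriv_def)
  have "riemann 3 (flow_metric t) l i j k x = 
     ((if k = l then log_deriv2 i j k x else 0) + (if j = l then log_deriv2 i k j x else 0)
       - (if j = k then log_deriv2 i l j x else 0)) -
     ((if k = l then log_deriv2 j i k x else 0) + (if i = l then log_deriv2 j k i x else 0)
       - (if i = k then log_deriv2 j l i x else 0)) +
     (\<Sum>m<3. flow_christoffel m j k x * flow_christoffel l i m x - flow_christoffel m i k x *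
         flow_christoffel l j m x)"
    unfolding riemann_def using assms by (simp add: coord_partial_christoffel
        christoffel_flow_metric)
  also have "\<dots> = (if i < 2 \<and> j < 2 \<and> k < 2 \<and> l < 2 then
        4 * w * w * ((if j = k \<and> i = l then 1 else 0) - (if i = k \<and> j = l then 1 else 0)) else 0)"
    using less_3_cases[OF assms(3)] less_3_cases[OF assms(4)] less_3_cases[OF assms(5)]
        less_3_cases[OF assms(6)] ww
    by (elim disjE; hypsubst; simp add: sum_less_3 flow_christoffel_def log_deriv2_def
        w[simplified] *)
      (simp_all add: algebra_simps)
  finally show ?thesis unfolding w .
qed

lemma ricci_flow_metric:
  assumes "t < 1" "x \<in> R3" "j < 3" "k < 3"
  shows "ricci 3 (flow_metric t) j k x = (if j = k \<and> j < 2 then sphere_density x else 0)"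
  using less_3_cases[OF assms(3)] less_3_cases[OF assms(4)]
  by (elim disjE) (simp_all add: ricci_def sum_less_3 riemann_flow_metric[OF assms(1,2)])


section \<open>The torsion form and the flow equations\<close>

text \<open>The derivative of log(\<open>sphere_density x * circle_density x\<close>), which is also
  the trace \<Gamma>^k_ik of the Christoffel symbols.\<close>

definition volume_log_deriv :: "nat \<Rightarrow> (nat \<Rightarrow> real) \<Rightarrow> real" where
  "volume_log_deriv i x = (if i < 2 then 2 * log_deriv i 0 x else log_deriv 2 2 x)"

lemma coord_partial_torsion_form:
  assumes "x \<in> R3" "i < 3"
  shows "coord_partial i (torsion_form is) x = volume_log_deriv i x * torsion_form is x"
proof (rule coord_partial_eqI(2)[OF openin_R3 assms refl])
  have "((\<lambda>s. levi_civita is * (sphere_density (x(i := s)) * circle_density (x(i := s))))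
      has_real_derivative
    levi_civita is * ((if i < 2 then 2 * log_deriv i 0 x * sphere_density x else 0) *
        circle_density x
      + (if i = 2 then log_deriv 2 2 x * circle_density x else 0) * sphere_density x)) (at (x i))"
    using DERIV_cmult[OF DERIV_mult[OF has_derivative_sphere_density[OF assms(2), of x]
        has_derivative_circle_density[OF assms(2), of x]], of "levi_civita is"]
    by (simp only: fun_upd_triv)
  moreover have "levi_civita is * ((if i < 2 then 2 * log_deriv i 0 x * sphere_density x else 0) *
      circle_density x
      + (if i = 2 then log_deriv 2 2 x * circle_density x else 0) * sphere_density x)
    = volume_log_deriv i x * torsion_form is x"
    using less_3_cases[OF assms(2)] by (auto simp: volume_log_deriv_def torsion_form_def)
  ultimately show "((\<lambda>s. torsion_form is (x(i := s))) has_real_derivative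
      volume_log_deriv i x * torsion_form is x) (at (x i))"
    by (simp only: torsion_form_def)
qed

text \<open>The form is the volume form of \<open>flow_metric t\<close> divided by sqrt(1 - t), and
  volume forms are parallel: the Christoffel terms add up to the trace, which cancels the
  logarithmic derivative.\<close>

lemma cov_deriv_torsion_form:
  assumes "t < 1" "x \<in> R3" "l < 3" "m < 3" "i < 3" "j < 3"
  shows "cov_deriv 3 (flow_metric t) l torsion_form [m, i, j] x = 0"
proof -
  have "cov_deriv 3 (flow_metric t) l torsion_form [m, i, j] x =
      volume_log_deriv l x * torsion_form [m, i, j] x -
      ((\<Sum>k<3. flow_christoffel k l m x * torsion_form [k, i, j] x) +
       (\<Sum>k<3. flow_christoffel k l i x * torsion_form [m, k, j] x) +
       (\<Sum>k<3. flow_christoffel k l j x * torsion_form [m, i, k] x))"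
    using assms by (simp add: cov_deriv_def coord_partial_torsion_form christoffel_flow_metric
        lessThan_Suc)
  also have "\<dots> = 0"
    using less_3_cases[OF assms(3)] less_3_cases[OF assms(4)] less_3_cases[OF assms(5)]
        less_3_cases[OF assms(6)]
    by (elim disjE; hypsubst)
      (simp_all add: sum_less_3 flow_christoffel_def torsion_form_def levi_civita_def
          volume_log_deriv_def log_deriv_def)
  finally show ?thesis .
qed

lemma codiff_torsion_form:
  assumes "t < 1" "x \<in> R3" "i < 3" "j < 3"
  shows "codiff 3 (flow_metric t) torsion_form [i, j] x = 0"
  unfolding codiff_def using assms by (simp add: cov_deriv_torsion_form)

text \<open>Two of four indices below 3 coincide, so the alternating sum cancels.\<close>

lemma ext_deriv_torsion_form:
  assumes "x \<in> R3" "i < 3" "j < 3" "k < 3" "l < 3"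
  shows "ext_deriv torsion_form [i, j, k, l] x = 0"
proof -
  have "ext_deriv torsion_form [i, j, k, l] x =
      volume_log_deriv i x * torsion_form [j, k, l] x - volume_log_deriv j x * torsion_form [i, k,
          l] x
      + volume_log_deriv k x * torsion_form [i, j, l] x - volume_log_deriv l x * torsion_form [i,
          j, k] x"
    using assms by (simp add: ext_deriv_def coord_partial_torsion_form lessThan_Suc)
  also have "\<dots> = 0"
    using less_3_cases[OF assms(2)] less_3_cases[OF assms(3)] less_3_cases[OF assms(4)]
        less_3_cases[OF assms(5)]
    by (elim disjE; hypsubst) (simp_all add: torsion_form_def levi_civita_def)
  finally show ?thesis .
qed

lemma coord_partial_zero:
  assumes "x \<in> R3" "i < 3" "\<And>y. y \<in> R3 \<Longrightarrow> F y = 0"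
  shows "coord_partial i F x = 0"
  by (rule coord_partial_eqI(2)[OF openin_R3 assms]) auto

text \<open>The codifferential and the exterior derivative vanish on the whole chart image, not
  merely at \<open>x\<close>, so their further derivatives vanish too. Thus a form constant in time
  solves the second flow equation.\<close>

lemma hodge_laplacian_torsion_form:
  assumes "t < 1" "x \<in> R3" "i < 3" "j < 3" "k < 3"
  shows "hodge_laplacian 3 (flow_metric t) torsion_form [i, j, k] x = 0"
proof -
  have "coord_partial m (codiff 3 (flow_metric t) torsion_form [a, b]) x = 0" if "m < 3" "a < 3"
      "b < 3" for m a b
    by (rule coord_partial_zero) (use assms that codiff_torsion_form in blast)+
  then have 1: "ext_deriv (codiff 3 (flow_metric t) torsion_form) [i, j, k] x = 0"
    using assms by (simp add: ext_deriv_def lessThan_Suc)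
  have "coord_partial l (ext_deriv torsion_form [m, i, j, k]) x = 0" if "l < 3" "m < 3" for l m
    by (rule coord_partial_zero) (use assms that ext_deriv_torsion_form in blast)+
  then have "cov_deriv 3 (flow_metric t) l (ext_deriv torsion_form) [m, i, j, k] x = 0" if "l < 3"
      "m < 3" for l m
    using assms that by (simp add: cov_deriv_def lessThan_Suc ext_deriv_torsion_form)
  then show ?thesis
    using 1 unfolding hodge_laplacian_def codiff_def by simp
qed

text \<open>In dimension three the volume form satisfies vol^2 = 2g, and the form here is vol/sqrt(1
  - t). Taking the trace, |H|^2 is three times the factor 2/(1 - t).\<close>

lemma H_square_torsion_form:
  assumes "t < 1" "x \<in> R3" "i < 3" "j < 3"
  shows "H_square 3 (flow_metric t) torsion_form i j x =
    (if i = j then 2 / (1 - t) * metric_diag t i x else 0)"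
proof -
  have "H_square 3 (flow_metric t) torsion_form i j x =
    (\<Sum>p<3. \<Sum>k<3. 1 / metric_diag t p x * (1 / metric_diag t k x) * torsion_form [i, p, k] x *
        torsion_form [j, p, k] x)"
    unfolding H_square_def
  proof (rule sum.cong[OF refl])
    fix p :: nat assume p: "p \<in> {..<3}"
    have "(\<Sum>q<3. \<Sum>k<3. \<Sum>l<3. inv_metric 3 (flow_metric t) p q x * inv_metric 3 (flow_metric t) k l
        x *
          torsion_form [i, p, k] x * torsion_form [j, q, l] x) =
       (\<Sum>q<3. if q = p then \<Sum>k<3. 1 / metric_diag t p x * (1 / metric_diag t k x) * torsion_form
           [i, p, k] x * torsion_form [j, p, k] x else 0)"
    proof (rule sum.cong[OF refl])
      fix q :: nat assume q: "q \<in> {..<3}"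
      have "(\<Sum>l<3. inv_metric 3 (flow_metric t) p q x * inv_metric 3 (flow_metric t) k l x *
          torsion_form [i, p, k] x * torsion_form [j, q, l] x) =
        (\<Sum>l<3. if l = k then (if q = p then 1 / metric_diag t p x * (1 / metric_diag t k x) *
            torsion_form [i, p, k] x * torsion_form [j, p, k] x else 0) else 0)"
        if "k < 3" for k
        using assms p q that by (intro sum.cong refl) (auto simp: inv_flow_metric)
      then show "(\<Sum>k<3. \<Sum>l<3. inv_metric 3 (flow_metric t) p q x * inv_metric 3 (flow_metric t) k
          l x *
          torsion_form [i, p, k] x * torsion_form [j, q, l] x) =
        (if q = p then \<Sum>k<3. 1 / metric_diag t p x * (1 / metric_diag t k x) * torsion_form [i, p,
            k] x * torsion_form [j, p, k] x else 0)"
        by simp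
    qed
    then show "(\<Sum>q<3. \<Sum>k<3. \<Sum>l<3. inv_metric 3 (flow_metric t) p q x * inv_metric 3 (flow_metric
        t) k l x *
          torsion_form [i, p, k] x * torsion_form [j, q, l] x) =
      (\<Sum>k<3. 1 / metric_diag t p x * (1 / metric_diag t k x) * torsion_form [i, p, k] x *
          torsion_form [j, p, k] x)"
      using p by simp
  qed
  also have "\<dots> = (if i = j then 2 / (1 - t) * metric_diag t i x else 0)"
  proof -
    define \<tau> u c where "\<tau> = 1 - t" and "u = sphere_density x" and "c = circle_density x"
    have nz: "\<tau> \<noteq> 0" "u \<noteq> 0" "c \<noteq> 0"
      using assms(1) sphere_density_pos[of x] circle_density_pos[of x] by (auto simp: \<tau>_def u_def
          c_def)
    have M: "metric_diag t k x = (if k < 2 then \<tau> * u else c\<^sup>2 / \<tau>)" for k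
      by (simp add: metric_diag_def \<tau>_def u_def c_def)
    show ?thesis
      unfolding M torsion_form_def \<tau>_def[symmetric] u_def[symmetric] c_def[symmetric]
      using less_3_cases[OF assms(3)] less_3_cases[OF assms(4)] nz
      by (elim disjE; hypsubst) (simp_all add: sum_less_3 levi_civita_def power2_eq_square)
  qed
  finally show ?thesis .
qed

lemma H_norm_sq_torsion_form:
  assumes "t < 1" "x \<in> R3"
  shows "H_norm_sq 3 (flow_metric t) torsion_form x = 6 / (1 - t)"
proof -
  have "H_norm_sq 3 (flow_metric t) torsion_form x = (\<Sum>i<3::nat. \<Sum>j<3. if j = i then 2 / (1 - t)
      else 0)"
    unfolding H_norm_sq_def
    using assms metric_diag_nz[OF assms(1)] by (intro sum.cong refl) (auto simp: inv_flow_metric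
        H_square_torsion_form)
  then show ?thesis by simp
qed

section \<open>The tensor transformation law between the charts\<close>

definition jac_re :: "bool \<Rightarrow> (nat \<Rightarrow> real) \<Rightarrow> real" where
  "jac_re a x = (if a then 1 else ((x 1)\<^sup>2 - (x 0)\<^sup>2) / ((x 0)\<^sup>2 + (x 1)\<^sup>2)\<^sup>2)"

text \<open>With \<open>jac_re\<close>, this is the derivative -1/z^2 of 1/z, split into real and
  imaginary part.\<close>

definition jac_im :: "bool \<Rightarrow> (nat \<Rightarrow> real) \<Rightarrow> real" where
  "jac_im a x = (if a then 0 else 2 * x 0 * x 1 / ((x 0)\<^sup>2 + (x 1)\<^sup>2)\<^sup>2)"

definition jac_circle :: "bool \<Rightarrow> (nat \<Rightarrow> real) \<Rightarrow> real" where
  "jac_circle b x = (if b then 1 else 1 / (x 2)\<^sup>2)"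

text \<open>
  \<open>transition_jac a b i j\<close> is the derivative of the \<open>j\<close>-th component in direction \<open>i\<close>. On the
  sphere it is multiplication by the complex number \<open>jac_re a x + \<i> jac_im a x\<close>.
\<close>

definition transition_jac :: "bool \<Rightarrow> bool \<Rightarrow> nat \<Rightarrow> nat \<Rightarrow> (nat \<Rightarrow> real) \<Rightarrow> real" where
  "transition_jac a b i j x =
     (if i = 2 \<and> j = 2 then jac_circle b x else if i = 2 \<or> j = 2 then 0
      else if i = j then jac_re a x else if i = 0 then jac_im a x else - jac_im a x)"

lemma has_derivative_transition:
  assumes "x \<in> overlap a b" "i < 3" "j < 3"
  shows "((\<lambda>s. transition a b (x(i := s)) j) has_real_derivative transition_jac a b i j x) (at (x
      i))"
proof -
  have x: "a \<or> (x 0)\<^sup>2 + (x 1)\<^sup>2 \<noteq> 0" "b \<or> x 2 \<noteq> 0"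
    using assms by (auto simp: overlap_def)
  have 1: "((\<lambda>s. s / (s\<^sup>2 + v\<^sup>2)) has_real_derivative (v\<^sup>2 - u\<^sup>2) / (u\<^sup>2 + v\<^sup>2)\<^sup>2) (at u)"
    "((\<lambda>s. v / (s\<^sup>2 + v\<^sup>2)) has_real_derivative - (2 * u * v / (u\<^sup>2 + v\<^sup>2)\<^sup>2)) (at u)"
    if "u\<^sup>2 + v\<^sup>2 \<noteq> 0" for u v :: real
    using that by (auto intro!: derivative_eq_intros simp: power2_eq_square)
  have 3: "((\<lambda>s. s / (u\<^sup>2 + s\<^sup>2)) has_real_derivative (u\<^sup>2 - v\<^sup>2) / (u\<^sup>2 + v\<^sup>2)\<^sup>2) (at v)"
    "((\<lambda>s. u / (u\<^sup>2 + s\<^sup>2)) has_real_derivative - (2 * u * v / (u\<^sup>2 + v\<^sup>2)\<^sup>2)) (at v)"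
    if "u\<^sup>2 + v\<^sup>2 \<noteq> 0" for u v :: real
    using that by (auto intro!: derivative_eq_intros simp: power2_eq_square)
  have 2: "((\<lambda>s. - 1 / s) has_real_derivative 1 / u\<^sup>2) (at u)" if "u \<noteq> 0" for u :: real
    using that by (auto intro!: derivative_eq_intros simp: divide_simps power2_eq_square)
  have T: "(\<lambda>s. transition a b (x(0 := s)) 0) = (if a then (\<lambda>s. s) else (\<lambda>s. s / (s\<^sup>2 + (x 1)\<^sup>2)))"
    "(\<lambda>s. transition a b (x(1 := s)) 0) = (if a then (\<lambda>s. x 0) else (\<lambda>s. x 0 / ((x 0)\<^sup>2 + s\<^sup>2)))"
    "(\<lambda>s. transition a b (x(0 := s)) 1) = (if a then (\<lambda>s. x 1) else (\<lambda>s. - (x 1 / (s\<^sup>2 + (x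
        1)\<^sup>2))))"
    "(\<lambda>s. transition a b (x(1 := s)) 1) = (if a then (\<lambda>s. s) else (\<lambda>s. - (s / ((x 0)\<^sup>2 + s\<^sup>2))))"
    by (auto simp: transition_def)
  have J: "jac_re a x = (if a then 1 else - (((x 0)\<^sup>2 - (x 1)\<^sup>2) / ((x 0)\<^sup>2 + (x 1)\<^sup>2)\<^sup>2))"
    by (simp add: jac_re_def minus_divide_left)
  have "((\<lambda>s. transition a b (x(0 := s)) 0) has_real_derivative jac_re a x) (at (x 0))"
    unfolding T jac_re_def using x(1) 1(1)[of "x 0" "x 1"] by (cases a) simp_all
  moreover have "((\<lambda>s. transition a b (x(1 := s)) 0) has_real_derivative - jac_im a x) (at (x 1))"
    unfolding T jac_im_def using x(1) 3(2)[of "x 0" "x 1"] by (cases a) (simp_all only: if_True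
        if_False minus_zero DERIV_const simp_thms)
  moreover have "((\<lambda>s. transition a b (x(0 := s)) 1) has_real_derivative jac_im a x) (at (x 0))"
    unfolding T jac_im_def using x(1) DERIV_minus[OF 1(2)[of "x 0" "x 1"]]
    by (cases a) (simp_all only: if_True if_False minus_minus DERIV_const simp_thms)
  moreover have "((\<lambda>s. transition a b (x(1 := s)) 1) has_real_derivative jac_re a x) (at (x 1))"
    unfolding T J using x(1) DERIV_minus[OF 3(1)[of "x 0" "x 1"]]
    by (cases a) (simp_all only: if_True if_False DERIV_ident simp_thms)
  moreover have "((\<lambda>s. transition a b (x(2 := s)) 2) has_real_derivative jac_circle b x) (at (x 2))"
    using x(2) 2[of "x 2"] by (cases b) (simp_all add: transition_def jac_circle_def)
  moreover have "((\<lambda>s. transition a b (x(k := s)) l) has_real_derivative 0) (at (x k))"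
    if "k < 2 \<and> l = 2 \<or> k = 2 \<and> l < 2" for k l
  proof -
    have "transition a b (x(k := s)) l = transition a b x l" for s
      using that by (auto simp: transition_def)
    then show ?thesis by simp
  qed
  moreover have "i = 0 \<or> i = 1 \<or> i = 2" "j = 0 \<or> j = 1 \<or> j = 2"
    using assms by linarith+
  ultimately show ?thesis
    by (elim disjE; hypsubst) (simp_all add: transition_jac_def)
qed

lemma coord_partial_transition:
  assumes "e \<in> sgns" "d \<in> sgns" "e' \<in> sgns" "d' \<in> sgns" "x \<in> overlap (e = e') (d = d')" "i < 3" "j
      < 3"
  shows "coord_partial i (\<lambda>x. stereo e' d' (chart_inv (stereo_chart e d) x) j) x = transition_jac
      (e = e') (d = d') i j x"
proof (rule coord_partial_eqI(2)[OF openin_overlap assms(5,6) _ has_derivative_transition[OF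
    assms(5-7)]])
  fix y assume "y \<in> overlap (e = e') (d = d')"
  then have "y \<in> R3" by (simp add: overlap_def)
  then show "stereo e' d' (chart_inv (stereo_chart e d) y) j = transition (e = e') (d = d') y j"
    using assms(1-4) by (simp only: chart_inv_stereo_chart stereo_unstereo_eq_transition)
qed

lemma density_transition:
  assumes "x \<in> overlap a b"
  shows "sphere_density (transition a b x) = (if a then 1 else ((x 0)\<^sup>2 + (x 1)\<^sup>2)\<^sup>2) *
      sphere_density x"
    and "circle_density (transition a b x) = (if b then 1 else (x 2)\<^sup>2) * circle_density x"
proof -
  have x: "a \<or> (x 0)\<^sup>2 + (x 1)\<^sup>2 \<noteq> 0" "b \<or> x 2 \<noteq> 0"
    using assms by (auto simp: overlap_def)
  show "sphere_density (transition a b x) = (if a then 1 else ((x 0)\<^sup>2 + (x 1)\<^sup>2)\<^sup>2) *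
      sphere_density x"
  proof (cases a)
    case False
    define r where "r = (x 0)\<^sup>2 + (x 1)\<^sup>2"
    have r: "r \<noteq> 0" "1 + r \<noteq> 0" using x False by (auto simp: r_def)
    have "(x 0 / r)\<^sup>2 + (- x 1 / r)\<^sup>2 = ((x 0)\<^sup>2 + (x 1)\<^sup>2) / r\<^sup>2"
      by (simp add: power_divide add_divide_distrib)
    also have "\<dots> = 1 / r"
      unfolding r_def[symmetric] using r(1) by (simp add: power2_eq_square)
    finally have "(x 0 / r)\<^sup>2 + (- x 1 / r)\<^sup>2 = 1 / r" .
    then have "1 + (x 0 / r)\<^sup>2 + (- x 1 / r)\<^sup>2 = (1 + r) / r"
      using r by (simp add: add.assoc add_divide_distrib)
    moreover have "sphere_density x = 4 / (1 + r)\<^sup>2"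
      by (simp add: sphere_density_def r_def add.assoc)
    moreover have "sphere_density (transition a b x) = 4 / (1 + (x 0 / r)\<^sup>2 + (- x 1 / r)\<^sup>2)\<^sup>2"
      using False by (simp add: sphere_density_def transition_def r_def)
    ultimately show ?thesis
      unfolding r_def[symmetric] using False by (simp add: power_divide)
  qed (simp add: sphere_density_def transition_def)
  show "circle_density (transition a b x) = (if b then 1 else (x 2)\<^sup>2) * circle_density x"
  proof (cases b)
    case False
    then have "1 + (- 1 / x 2)\<^sup>2 = (1 + (x 2)\<^sup>2) / (x 2)\<^sup>2"
      using x by (simp add: field_simps)
    then show ?thesis using False by (simp add: circle_density_def transition_def)
  qed (simp add: circle_density_def transition_def)
qed

text \<open>The coordinate changes are isometries of the round sphere and the round circle. Both
  transformation laws, and the independence of the speed of a curve from the chart, reduce to these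
  two identities.\<close>

lemma jac_density:
  assumes "x \<in> overlap a b"
  shows "((jac_re a x)\<^sup>2 + (jac_im a x)\<^sup>2) * sphere_density (transition a b x) = sphere_density x"
    and "jac_circle b x * circle_density (transition a b x) = circle_density x"
proof -
  have x: "a \<or> (x 0)\<^sup>2 + (x 1)\<^sup>2 \<noteq> 0" "b \<or> x 2 \<noteq> 0"
    using assms by (auto simp: overlap_def)
  have *: "((v\<^sup>2 - u\<^sup>2) / r\<^sup>2)\<^sup>2 + (2 * u * v / r\<^sup>2)\<^sup>2 = 1 / r\<^sup>2"
    if "r \<noteq> 0" "r = u\<^sup>2 + v\<^sup>2" for u v r :: real
  proof -
    have "((v\<^sup>2 - u\<^sup>2) / r\<^sup>2)\<^sup>2 + (2 * u * v / r\<^sup>2)\<^sup>2 = ((v\<^sup>2 - u\<^sup>2)\<^sup>2 + (2 * u * v)\<^sup>2) / (r\<^sup>2)\<^sup>2"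
      by (simp only: power_divide add_divide_distrib)
    also have "(v\<^sup>2 - u\<^sup>2)\<^sup>2 + (2 * u * v)\<^sup>2 = r\<^sup>2"
      unfolding that(2) by (simp add: power2_eq_square algebra_simps)
    finally show ?thesis using that(1) by (simp add: power2_eq_square)
  qed
  show "((jac_re a x)\<^sup>2 + (jac_im a x)\<^sup>2) * sphere_density (transition a b x) = sphere_density x"
  proof (cases a)
    case False
    then have "(jac_re a x)\<^sup>2 + (jac_im a x)\<^sup>2 = 1 / ((x 0)\<^sup>2 + (x 1)\<^sup>2)\<^sup>2"
      unfolding jac_re_def jac_im_def using x *[OF _ refl, of "x 0" "x 1"] by simp
    then show ?thesis using False x density_transition(1)[OF assms] by simp
  next
    case True
    then show ?thesis using density_transition(1)[OF assms] by (simp add: jac_re_def jac_im_def)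
  qed
  show "jac_circle b x * circle_density (transition a b x) = circle_density x"
    using x(2) density_transition(2)[OF assms] by (cases b) (simp_all add: jac_circle_def)
qed

text \<open>By the Cauchy-Riemann form of the Jacobian on the sphere, its rows are orthogonal and of
  equal length, so a multiple of |dz|^2 pulls back to such a multiple.\<close>

lemma transition_jac_conformal:
  assumes "x \<in> overlap a b" "i < 3" "j < 3"
  shows "(\<Sum>k<3. transition_jac a b i k x * transition_jac a b j k x * metric_diag t k (transition
      a b x)) =
     (if i = j then metric_diag t i x else 0)"
proof -
  have "metric_diag t 2 x = (jac_circle b x * circle_density (transition a b x))\<^sup>2 / (1 - t)"
    by (simp add: jac_density(2)[OF assms(1)] metric_diag_def)
  moreover have "metric_diag t k x = (1 - t) * (((jac_re a x)\<^sup>2 + (jac_im a x)\<^sup>2) * sphere_density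
      (transition a b x))"
    if "k < 2" for k
    using that by (simp add: jac_density(1)[OF assms(1)] metric_diag_def)
  ultimately show ?thesis
    using less_3_cases[OF assms(2)] less_3_cases[OF assms(3)]
    by (elim disjE; hypsubst)
      (simp_all add: sum_less_3 transition_jac_def metric_diag_def[of t _ "transition a b x"]
          power2_eq_square algebra_simps)
qed

lemma multi_indices_nth:
  assumes "is \<in> multi_indices n k" "m < k"
  shows "is ! m < n"
proof -
  have "is ! m \<in> set is" using assms by (intro nth_mem) (simp add: multi_indices_def)
  moreover have "set is \<subseteq> {..<n}" using assms by (simp add: multi_indices_def)
  ultimately show ?thesis by blast
qed

text \<open>For a field with the same expression in all charts, the transformation law depends on a
  pair of charts only through whether their poles agree.\<close>

lemma is_tensor_field_constI:
  assumes "\<And>a b x is. x \<in> overlap a b \<Longrightarrow> is \<in> multi_indices 3 k \<Longrightarrow>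
    S is x = (\<Sum>js\<in>multi_indices 3 k. (\<Prod>m<k. transition_jac a b (is ! m) (js ! m) x) * S js
        (transition a b x))"
  shows "is_tensor_field 3 stereo_atlas k (\<lambda>_. S)"
  unfolding is_tensor_field_def ball_stereo_atlas stereo_chart_simps
proof (intro ballI)
  fix e d e' d' p "is"
  assume s: "e \<in> sgns" "d \<in> sgns" "e' \<in> sgns" "d' \<in> sgns"
    and p: "p \<in> stereo_dom e d \<inter> stereo_dom e' d'" and "is": "is \<in> multi_indices 3 k"
  define x where "x = stereo e d p"
  have x: "x \<in> overlap (e = e') (d = d')"
    using p stereo_image_overlap[OF s] by (auto simp: x_def)
  then have "x \<in> R3" by (simp add: overlap_def)
  have p': "p = unstereo e d x"
    using p unstereo_stereo[of p e d] s by (simp add: x_def)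
  have "stereo e' d' p = transition (e = e') (d = d') x"
    unfolding p' by (rule stereo_unstereo_eq_transition[OF s \<open>x \<in> R3\<close>])
  moreover have "coord_partial (is ! m) (\<lambda>x. stereo e' d' (chart_inv (stereo_chart e d) x) (js !
      m)) x =
      transition_jac (e = e') (d = d') (is ! m) (js ! m) x" if "js \<in> multi_indices 3 k" "m < k"
          for js m
  proof (rule coord_partial_transition[OF s x])
    show "is ! m < 3" "js ! m < 3"
      using multi_indices_nth "is" that by blast+
  qed
  ultimately show "S is (stereo e d p) = (\<Sum>js\<in>multi_indices 3 k. (\<Prod>a<k. coord_partial (is ! a)
      (\<lambda>x. stereo e' d' (chart_inv (stereo_chart e d) x) (js ! a)) (stereo e d p)) * S js (stereo
          e' d' p))"
    unfolding x_def[symmetric] using assms[OF x "is"] by simp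
qed

lemma is_tensor_field_flow_metric:
  assumes "t < 1"
  shows "is_tensor_field 3 stereo_atlas 2 (\<lambda>_. flow_metric t)"
proof (rule is_tensor_field_constI)
  fix a b x "is" assume x: "x \<in> overlap a b" and "is \<in> multi_indices 3 2"
  then obtain i j where ij: "is = [i, j]" "i < 3" "j < 3" by (elim multi_indices_2E)
  have "(\<Sum>js\<in>multi_indices 3 2. (\<Prod>m<2. transition_jac a b (is ! m) (js ! m) x) * flow_metric t js
      (transition a b x)) =
     (\<Sum>k<3. \<Sum>l<3. if l = k then transition_jac a b i k x * transition_jac a b j k x * metric_diag
         t k (transition a b x) else 0)"
    unfolding sum_multi_indices_2 ij(1) by (intro sum.cong refl) (simp add: eval_nat_numeral
        flow_metric_def)
  also have "\<dots> = flow_metric t is x"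
    using transition_jac_conformal[OF x ij(2,3)] by (simp add: flow_metric_def ij(1))
  finally show "flow_metric t is x = (\<Sum>js\<in>multi_indices 3 2. (\<Prod>m<2. transition_jac a b (is ! m)
      (js ! m) x) * flow_metric t js (transition a b x))"
    by simp
qed

lemma is_tensor_field_torsion_form: "is_tensor_field 3 stereo_atlas 3 (\<lambda>_. torsion_form)"
proof (rule is_tensor_field_constI)
  fix a b x "is" assume x: "x \<in> overlap a b" and "is \<in> multi_indices 3 3"
  then obtain i j k where ijk: "is = [i, j, k]" "i < 3" "j < 3" "k < 3" by (elim multi_indices_3E)
  define J where "J i j = transition_jac a b i j x" for i j
  define v where "v = sphere_density (transition a b x) * circle_density (transition a b x)"
  have J: "J 0 0 = jac_re a x" "J (Suc 0) (Suc 0) = jac_re a x" "J 0 (Suc 0) = jac_im a x" "J (Suc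
      0) 0 = - jac_im a x"
    "J 2 2 = jac_circle b x" "J 0 2 = 0" "J (Suc 0) 2 = 0" "J 2 0 = 0" "J 2 (Suc 0) = 0"
    by (simp_all add: J_def transition_jac_def)
  have "(\<Sum>js\<in>multi_indices 3 3. (\<Prod>m<3. transition_jac a b (is ! m) (js ! m) x) * torsion_form js
      (transition a b x)) =
     (\<Sum>p<3. \<Sum>q<3. \<Sum>r<3. J i p * J j q * J k r * (levi_civita [p, q, r] * v))"
    unfolding sum_multi_indices_3 ijk(1) by (intro sum.cong refl) (simp add: eval_nat_numeral
        torsion_form_def v_def J_def)
  \<comment> \<open>The determinant of the Jacobian appears. It is positive because the charts are
    oriented consistently, so no sign has to be absorbed.\<close>
  also have "\<dots> = levi_civita [i, j, k] * ((((jac_re a x)\<^sup>2 + (jac_im a x)\<^sup>2) * jac_circle b x) * v)"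
    using less_3_cases[OF ijk(2)] less_3_cases[OF ijk(3)] less_3_cases[OF ijk(4)]
    by (elim disjE; hypsubst) (simp_all add: sum_less_3 levi_civita_def J power2_eq_square
        algebra_simps)
  also have "\<dots> = levi_civita [i, j, k] * ((((jac_re a x)\<^sup>2 + (jac_im a x)\<^sup>2) * sphere_density
      (transition a b x)) * (jac_circle b x * circle_density (transition a b x)))"
    by (simp add: v_def)
  also have "\<dots> = torsion_form is x"
    by (simp add: jac_density[OF x] torsion_form_def ijk(1))
  finally show "torsion_form is x = (\<Sum>js\<in>multi_indices 3 3. (\<Prod>m<3. transition_jac a b (is ! m) (js
      ! m) x) * torsion_form js (transition a b x))"
    by simp
qed

section \<open>The remaining conditions on the flow and its equations\<close>

lemma riemannian_metric_flow_metric: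
  assumes "t < 1"
  shows "riemannian_metric 3 stereo_atlas (\<lambda>_. flow_metric t)"
  unfolding riemannian_metric_def
proof (intro conjI ballI allI impI is_tensor_field_flow_metric[OF assms])
  show "flow_metric t [i, j] x = flow_metric t [j, i] x" for i j x
    by (auto simp: flow_metric_def)
  show "0 < (\<Sum>i<3. \<Sum>j<3. flow_metric t [i, j] x * v i * v j)" if v: "\<exists>i<3. v i \<noteq> 0" for v :: "nat
      \<Rightarrow> real" and x
  proof -
    have "(\<Sum>i<3. \<Sum>j<3. flow_metric t [i, j] x * v i * v j) = (\<Sum>i<3. metric_diag t i x * (v i)\<^sup>2)"
      by (simp add: sum_less_3 flow_metric_def power2_eq_square mult.assoc)
    moreover obtain i where "i < 3" "v i \<noteq> 0" using v by blast
    then have "0 < (\<Sum>i<3. metric_diag t i x * (v i)\<^sup>2)"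
      using metric_diag_pos[OF assms] by (intro sum_pos2[of _ i]) (simp_all add: less_imp_le)
    ultimately show ?thesis by simp
  qed
qed

lemma alternating_torsion_form: "alternating 3 stereo_atlas 3 (\<lambda>_. torsion_form)"
  unfolding alternating_def
proof (intro ballI allI impI)
  fix x "is" and a b :: nat assume "is \<in> multi_indices 3 3" and ab: "a < 3" "b < 3" "a \<noteq> b"
  then obtain i j k where ijk: "is = [i, j, k]" "i < 3" "j < 3" "k < 3" by (elim multi_indices_3E)
  have "levi_civita (is[a := is ! b, b := is ! a]) = - levi_civita is"
    unfolding ijk(1)
    using less_3_cases[OF ijk(2)] less_3_cases[OF ijk(3)] less_3_cases[OF ijk(4)] less_3_cases[OF
        ab(1)] less_3_cases[OF ab(2)] ab(3)
    by (elim disjE; hypsubst) (simp_all add: levi_civita_def eval_nat_numeral)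
  then show "torsion_form (is[a := is ! b, b := is ! a]) x = - torsion_form is x"
    by (simp add: torsion_form_def)
qed

lemma closed_torsion_form: "closed_form 3 stereo_atlas 3 (\<lambda>_. torsion_form)"
  unfolding closed_form_def
proof (intro ballI)
  fix c x "is" assume "c \<in> stereo_atlas" "x \<in> chart_image c" "is \<in> multi_indices 3 (Suc 3)"
  then have "x \<in> R3" "is \<in> multi_indices 3 4" using chart_image_stereo by auto
  then show "ext_deriv torsion_form is x = 0"
    by (elim multi_indices_4E) (simp only: ext_deriv_torsion_form)
qed

text \<open>A connected set with more than one point has no isolated points. At t = 0 this concerns
  the one-sided derivative.\<close>

lemma not_trivial_within_unit_interval: "t \<in> {0..<1} \<Longrightarrow> at t within {0..<1} \<noteq> (bot :: real filter)"
proof -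
  have "(0::real) \<in> {0..<1}" "(1 / 2 :: real) \<in> {0..<1}" "(0::real) \<noteq> 1 / 2" by simp_all
  then have "connected {0..<1::real}" "{0..<1::real} \<noteq> {t}" for t
    by (simp, metis singletonD)
  then show "t \<in> {0..<1} \<Longrightarrow> at t within {0..<1} \<noteq> (bot :: real filter)"
    unfolding trivial_limit_within using connected_imp_perfect by blast
qed

lemma smooth_flow_metric:
  assumes "is \<in> multi_indices 3 2"
  shows "smooth_spacetime_on 3 {0..<1} R3 (\<lambda>t. flow_metric t is)"
proof (rule smooth_spacetime_on_rational[OF openin_R3 not_trivial_within_unit_interval _ refl])
  show "rational_on {0..<1} R3 (\<lambda>t. flow_metric t is)"
    unfolding flow_metric_def metric_diag_def sphere_density_def circle_density_def
    by (cases "is ! 0 = is ! 1"; cases "is ! 0 < 2") (auto intro!: rational_on_intros)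
qed

lemma smooth_torsion_form: "smooth_spacetime_on 3 {0..<1} R3 (\<lambda>t. torsion_form is)"
proof (rule smooth_spacetime_on_rational[OF openin_R3 not_trivial_within_unit_interval _ refl])
  show "rational_on {0..<1} R3 (\<lambda>t. torsion_form is)"
    unfolding torsion_form_def sphere_density_def circle_density_def
    by (auto intro!: rational_on_intros)
qed

lemma generalized_ricci_flow_flow_metric:
  "generalized_ricci_flow 3 stereo_atlas 1 (\<lambda>t _. flow_metric t) (\<lambda>t _. torsion_form)"
  unfolding generalized_ricci_flow_def
proof (intro conjI ballI allI impI)
  show "smooth_tensor_family 3 stereo_atlas {0..<1} 2 (\<lambda>t _. flow_metric t)"
    unfolding smooth_tensor_family_def
    using is_tensor_field_flow_metric smooth_flow_metric chart_image_stereo by simp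
  show "smooth_tensor_family 3 stereo_atlas {0..<1} 3 (\<lambda>t _. torsion_form)"
    unfolding smooth_tensor_family_def
    using is_tensor_field_torsion_form smooth_torsion_form chart_image_stereo by simp
next
  fix t c x and i j :: nat
  assume t: "t \<in> {0..<1::real}" and "c \<in> stereo_atlas" "x \<in> chart_image c" and ij: "i < 3" "j < 3"
  then have x: "x \<in> R3" using chart_image_stereo by blast
  have t1: "t < 1" using t by simp
  \<comment> \<open>Here c is a component of the round metric, constant in time. The two right-hand
    sides are -2c + c = -c on the sphere and c/(1 - t)^2 on the circle; the terms with factor 1/2
    come from H^2 = 2/(1 - t) g.\<close>
  have "((\<lambda>s. (1 - s) * c) has_real_derivative - 2 * c + (1 / 2) * (2 / (1 - t) * ((1 - t) * c)))
      (at t within {0..<1})" for c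
    using t1 by (auto intro!: derivative_eq_intros)
  moreover have "((\<lambda>s. c / (1 - s)) has_real_derivative (1 / 2) * (2 / (1 - t) * (c / (1 - t))))
      (at t within {0..<1})" for c
    using t1 by (auto intro!: derivative_eq_intros simp: power2_eq_square)
  ultimately have "((\<lambda>s. metric_diag s i x) has_real_derivative
      - 2 * (if i < 2 then sphere_density x else 0) + (1 / 2) * (2 / (1 - t) * metric_diag t i x))
          (at t within {0..<1})"
    by (cases "i < 2") (simp_all only: metric_diag_def if_True if_False mult_zero_right add_0)
  then show "((\<lambda>s. flow_metric s [i, j] x) has_real_derivative
      - 2 * ricci 3 (flow_metric t) i j x + (1 / 2) * H_square 3 (flow_metric t) torsion_form i j
          x) (at t within {0..<1})"
    using ricci_flow_metric[OF t1 x ij] H_square_torsion_form[OF t1 x ij]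
    by (cases "i = j") (simp_all add: flow_metric_def)
next
  fix t c x "is"
  assume t: "t \<in> {0..<1::real}" and "c \<in> stereo_atlas" "x \<in> chart_image c" and "is": "is \<in>
      multi_indices 3 3"
  then have x: "x \<in> R3" using chart_image_stereo by blast
  have "hodge_laplacian 3 (flow_metric t) torsion_form is x = 0"
    using "is" t x by (elim multi_indices_3E) (simp add: hodge_laplacian_torsion_form)
  then show "((\<lambda>s. torsion_form is x) has_real_derivative - hodge_laplacian 3 (flow_metric t)
      torsion_form is x) (at t within {0..<1})"
    by simp
qed (use riemannian_metric_flow_metric alternating_torsion_form closed_torsion_form in auto)


section \<open>Non-existence of torsion-bounding functions\<close>

text \<open>Continuity is asked only in the charts, where the regularity of \<psi> is given. The
  maximum is returned as a point of a chart, so that coordinate derivatives can be tested there at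
  once.\<close>

lemma attains_max_on_sphere_circle:
  fixes u :: "real \<Rightarrow> (nat \<Rightarrow> real) \<Rightarrow> real"
  assumes cont: "\<And>e d. e \<in> sgns \<Longrightarrow> d \<in> sgns \<Longrightarrow> continuous_on (J \<times> unit_cube) (\<lambda>(t, x). u t (unstereo
      e d x))"
    and J: "compact J" "J \<noteq> {}"
  obtains t e d x where "t \<in> J" "e \<in> sgns" "d \<in> sgns" "x \<in> unit_cube"
    "\<And>s p. s \<in> J \<Longrightarrow> p \<in> sphere_circle \<Longrightarrow> u s p \<le> u t (unstereo e d x)"
proof -
  have "(\<lambda>i. 0) \<in> unit_cube" by (simp add: unit_cube_def)
  then have ne: "J \<times> unit_cube \<noteq> {}" using J by blast
  have K: "compact (J \<times> unit_cube)"
    using J compact_unit_cube by (intro compact_Times)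
  define U where "U = (\<Union>e\<in>sgns. \<Union>d\<in>sgns. (\<lambda>(t, x). u t (unstereo e d x)) ` (J \<times> unit_cube))"
  have "compact U"
    unfolding U_def using cont K by (intro compact_UN compact_continuous_image) auto
  moreover have "U \<noteq> {}" using ne by (auto simp: U_def)
  ultimately obtain m where m: "m \<in> U" "\<And>y. y \<in> U \<Longrightarrow> y \<le> m"
    using compact_attains_sup by metis
  have "u s p \<in> U" if s: "s \<in> J" and p: "p \<in> sphere_circle" for s p
  proof -
    obtain e d x where *: "e \<in> sgns" "d \<in> sgns" "x \<in> unit_cube" "p = unstereo e d x"
      using sphere_circle_covered[OF p] by metis
    then have "u s p = (\<lambda>(t, x). u t (unstereo e d x)) (s, x)" "(s, x) \<in> J \<times> unit_cube"
      using s by auto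
    then show ?thesis
      unfolding U_def using *(1,2) by (intro UN_I image_eqI)
  qed
  moreover obtain t e d x where "t \<in> J" "e \<in> sgns" "d \<in> sgns" "x \<in> unit_cube" "m = u t (unstereo e
      d x)"
    using m(1) unfolding U_def by (elim UN_E imageE SigmaE) auto
  ultimately show ?thesis
    using that[of t e d x] m(2) by blast
qed

text \<open>If D were positive, f' would be positive just to the right of a critical point, and by
  the mean value theorem f would exceed its maximum.\<close>

lemma second_derivative_nonpos_at_max:
  fixes f :: "real \<Rightarrow> real"
  assumes f: "\<And>s. (f has_real_derivative f' s) (at s)" and f': "(f' has_real_derivative D) (at a)"
    and max: "\<And>s. f s \<le> f a"
  shows "f' a = 0" "D \<le> 0"
proof -
  show 0: "f' a = 0"
    using DERIV_local_max[OF f[of a], of 1] max by simp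
  show "D \<le> 0"
  proof (rule ccontr)
    assume "\<not> D \<le> 0"
    then obtain d where d: "d > 0" "\<And>h. 0 < h \<Longrightarrow> h < d \<Longrightarrow> f' a < f' (a + h)"
      using DERIV_pos_inc_right[OF f'] by (metis not_le)
    obtain z where z: "a < z" "z < a + d / 2" "f (a + d / 2) - f a = (a + d / 2 - a) * f' z"
      using MVT2[of a "a + d / 2" f f'] f d(1) by auto
    have "0 < f' z"
      using d(2)[of "z - a"] z d(1) 0 by simp
    then have "0 < (a + d / 2 - a) * f' z"
      using d(1) by (intro mult_pos_pos) auto
    then have "f a < f (a + d / 2)" using z(3) by linarith
    then show False using max[of "a + d / 2"] by simp
  qed
qed

text \<open>At the maximum the gradient vanishes, which removes the Christoffel terms, and the
  diagonal metric leaves only pure second derivatives with positive weights. As the chart image is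
  all of R^3, the one-variable test applies on entire coordinate lines.\<close>

lemma laplacian_nonpos_at_max:
  assumes t: "t < 1" and x: "x \<in> R3" and max: "\<And>y. y \<in> R3 \<Longrightarrow> u y \<le> u x"
    and d1: "\<And>y i. y \<in> R3 \<Longrightarrow> i < 3 \<Longrightarrow> (\<lambda>s. u (y(i := s))) field_differentiable (at (y i))"
    and d2: "\<And>y i. y \<in> R3 \<Longrightarrow> i < 3 \<Longrightarrow> (\<lambda>s. coord_partial i u (y(i := s))) field_differentiable (at
        (y i))"
  shows "laplacian 3 (flow_metric t) u x \<le> 0"
proof -
  have *: "coord_partial i u x = 0 \<and> coord_partial i (coord_partial i u) x \<le> 0" if i: "i < 3" for i
  proof -
    have R3: "x(i := s) \<in> R3" for s using x i by auto
    have "((\<lambda>s. u (x(i := s))) has_real_derivative coord_partial i u (x(i := s))) (at s)" for s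
      using d1[OF R3 i, of s] unfolding coord_partial_def by (simp add:
          DERIV_deriv_iff_field_differentiable)
    moreover have "((\<lambda>s. coord_partial i u (x(i := s))) has_real_derivative coord_partial i
        (coord_partial i u) x) (at (x i))"
      using d2[OF x i] unfolding coord_partial_def[of i "coord_partial i u"] by (simp only:
          DERIV_deriv_iff_field_differentiable)
    moreover have "u (x(i := s)) \<le> u (x(i := x i))" for s
      using max[OF R3] by simp
    ultimately show ?thesis
      using second_derivative_nonpos_at_max[of "\<lambda>s. u (x(i := s))" "\<lambda>s. coord_partial i u (x(i :=
          s))" _ "x i"] by simp
  qed
  have "laplacian 3 (flow_metric t) u x = (\<Sum>i<3. \<Sum>j<3. if j = i then 1 / metric_diag t i x *
      coord_partial i (coord_partial i u) x else 0)"
    unfolding laplacian_def using t * by (intro sum.cong refl) (auto simp: inv_flow_metric)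
  also have "\<dots> = (\<Sum>i<3. 1 / metric_diag t i x * coord_partial i (coord_partial i u) x)"
    by simp
  also have "\<dots> \<le> 0"
    using * metric_diag_pos[OF t, of _ x]
    by (intro sum_nonpos mult_nonneg_nonpos) (simp_all add: less_imp_le)
  finally show ?thesis .
qed

lemma no_torsion_bounding_function:
  "\<not> torsion_bounding 3 (top_of_set sphere_circle) stereo_atlas 1 (\<lambda>t _. flow_metric t) (\<lambda>t _.
      torsion_form) \<psi>"
proof
  assume tb: "torsion_bounding 3 (top_of_set sphere_circle) stereo_atlas 1 (\<lambda>t _. flow_metric t)
      (\<lambda>t _. torsion_form) \<psi>"
  define F where "F e d t x = \<psi> t (chart_inv (stereo_chart e d) x)" for e d t x
  have F_eq: "F e d = (\<lambda>t x. \<psi> t (chart_inv (stereo_chart e d) x))" for e d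
    by (simp add: F_def fun_eq_iff)
  have F: "F e d t x = \<psi> t (unstereo e d x)" if "e \<in> sgns" "d \<in> sgns" "x \<in> R3" for e d t x
    using chart_inv_stereo_chart[OF that] by (simp add: F_def)
  have nonneg: "0 \<le> \<psi> t p" if "t \<in> {0..<1}" "p \<in> sphere_circle" for t p
    using tb that by (simp add: torsion_bounding_def)
  have Ck: "Ck_spacetime_on 3 {0..<1} R3 k (F e d)" if "e \<in> sgns" "d \<in> sgns" for e d k
    using tb stereo_chart_in_atlas[OF that]
    unfolding torsion_bounding_def smooth_spacetime_on_def F_eq
      chart_image_stereo[OF stereo_chart_in_atlas[OF that], symmetric] by blast
  have ineq: "time_deriv {0..<1} (F e d) t x - laplacian 3 (flow_metric t) (F e d t) x \<le> - (6 / (1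
      - t))"
    if "e \<in> sgns" "d \<in> sgns" "t \<in> {0..<1}" "x \<in> R3" for e d t x
  proof -
    have "time_deriv {0..<1} (F e d) t x - laplacian 3 (flow_metric t) (F e d t) x \<le> - H_norm_sq 3
        (flow_metric t) torsion_form x"
      using tb stereo_chart_in_atlas[OF that(1,2)] that(3,4)
      unfolding torsion_bounding_def F_eq
        chart_image_stereo[OF stereo_chart_in_atlas[OF that(1,2)], symmetric] by blast
    then show ?thesis using that by (simp add: H_norm_sq_torsion_form)
  qed
  have cont: "continuous_on ({0..<1} \<times> R3) (\<lambda>(t, x). F e d t x)" if "e \<in> sgns" "d \<in> sgns" for e d
    using Ck[OF that, of 0] by (simp add: subtopology_Euclidean_space[OF openin_R3])

  \<comment> \<open>The time derivative 6/(1 - t) of the logarithmic term compensates -|H|^2, and -t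
    leaves a strictly negative remainder.\<close>
  define u where "u t p = \<psi> t p - 6 * ln (1 - t) - t" for t p
  have cube: "unit_cube \<subseteq> R3" by (auto simp: unit_cube_def)
  have cont_u: "continuous_on ({0..T} \<times> unit_cube) (\<lambda>(t, x). u t (unstereo e d x))"
    if "e \<in> sgns" "d \<in> sgns" "T < 1" for e d T
  proof -
    have "continuous_on ({0..T} \<times> unit_cube) (\<lambda>(t, x). F e d t x)"
      using cube that by (intro continuous_on_subset[OF cont[OF that(1,2)]]) auto
    then have "continuous_on ({0..T} \<times> unit_cube) (\<lambda>p. (case p of (t, x) \<Rightarrow> F e d t x) - 6 * ln (1
        - fst p) - fst p)"
      using that by (intro continuous_intros) auto
    then show ?thesis
      by (rule continuous_on_eq) (use that cube F in \<open>auto simp: u_def\<close>)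
  qed
  \<comment> \<open>At time 0 the functions \<open>u\<close> and \<psi> agree, so the degenerate
    time interval {0..0} provides the bound.\<close>
  have "\<exists>C. \<forall>p\<in>sphere_circle. \<psi> 0 p \<le> C"
    by (rule attains_max_on_sphere_circle[of "{0..0}" u, OF cont_u]) (auto simp: u_def)
  then obtain C where C: "\<And>p. p \<in> sphere_circle \<Longrightarrow> \<psi> 0 p \<le> C" by blast
  have p0: "unstereo 1 1 (\<lambda>i. 0) \<in> sphere_circle"
    using unstereo_in_dom[of 1 1] by (simp add: stereo_dom_def)
  have "0 \<le> C" using C[OF p0] nonneg[of 0, OF _ p0] by simp
  \<comment> \<open>At time T nonnegativity of \<psi> gives u \<ge> C + 2 - T > C, so that the
    maximum over [0, T] cannot lie at time 0.\<close>
  define T where "T = 1 - exp (- (C + 2) / 6)"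
  have T: "0 \<le> T" "T < 1" "6 * ln (1 - T) = - (C + 2)"
    using \<open>0 \<le> C\<close> by (simp_all add: T_def)
  obtain t e d x where tx: "t \<in> {0..T}" "e \<in> sgns" "d \<in> sgns" "x \<in> unit_cube"
    and max: "\<And>s p. s \<in> {0..T} \<Longrightarrow> p \<in> sphere_circle \<Longrightarrow> u s p \<le> u t (unstereo e d x)"
    by (rule attains_max_on_sphere_circle[of "{0..T}" u, OF cont_u]) (use T in auto)
  have t1: "t \<in> {0..<1}" "t < 1" using tx(1) T by auto
  have x: "x \<in> R3" using tx(4) cube by blast
  have M: "unstereo e d y \<in> sphere_circle" for y
    using unstereo_in_dom[OF tx(2,3)] by (simp add: stereo_dom_def)
  show False
  proof (cases "t = 0")
    case True
    have "0 - 6 * ln (1 - T) - T \<le> u T (unstereo 1 1 (\<lambda>i. 0))"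
      using nonneg[of T, OF _ p0] T by (simp add: u_def)
    also have "\<dots> \<le> u t (unstereo e d x)" using max p0 T by simp
    also have "\<dots> \<le> C" using C M True by (simp add: u_def)
    finally show False using T by simp
  next
    case False
    then have t0: "0 < t" using tx(1) by simp
    note Ck1 = Ck[OF tx(2,3), of "Suc 0"] and Ck2 = Ck[OF tx(2,3), of "Suc (Suc 0)"]
    have "laplacian 3 (flow_metric t) (F e d t) x \<le> 0"
    proof (rule laplacian_nonpos_at_max[OF t1(2) x])
      show "F e d t y \<le> F e d t x" if "y \<in> R3" for y
        using max[OF tx(1) M, of y] F[OF tx(2,3)] that x by (simp add: u_def)
      show "(\<lambda>s. F e d t (y(i := s))) field_differentiable (at (y i))" if "y \<in> R3" "i < 3" for y i
        using Ck1 that t1 by simp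
      show "(\<lambda>s. coord_partial i (F e d t) (y(i := s))) field_differentiable (at (y i))" if "y \<in>
          R3" "i < 3" for y i
        using Ck2 that t1 by simp
    qed
    then have D: "time_deriv {0..<1} (F e d) t x \<le> - (6 / (1 - t))"
      using ineq[OF tx(2,3) t1(1) x] by linarith
    have "(\<lambda>s. F e d s x) differentiable (at t within {0..<1})"
      using Ck1 x t1 by simp
    then have "((\<lambda>s. F e d s x) has_real_derivative time_deriv {0..<1} (F e d) t x) (at t within
        {0..<1})"
      unfolding time_deriv_def has_real_derivative_iff_has_vector_derivative
      by (simp add: vector_derivative_works)
    moreover have "at t within {0..<1} = at t"
      using t0 t1 by (intro at_within_open_subset[of _ "{0<..<1}"]) auto
    ultimately have "((\<lambda>s. F e d s x) has_real_derivative time_deriv {0..<1} (F e d) t x) (at t)"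
        by simp
    then have "((\<lambda>s. F e d s x - 6 * ln (1 - s) - s) has_real_derivative
        time_deriv {0..<1} (F e d) t x + 6 / (1 - t) - 1) (at t)"
      using t1 by (auto intro!: derivative_eq_intros simp: field_simps)
    moreover have "time_deriv {0..<1} (F e d) t x + 6 / (1 - t) - 1 < 0" using D by linarith
    \<comment> \<open>As t may equal T, only earlier times can be compared: a negative derivative
      makes u larger just before t. The minimum with t below keeps the earlier time
      nonnegative.\<close>
    ultimately obtain h where h: "h > 0" "\<And>s. 0 < s \<Longrightarrow> s < h \<Longrightarrow>
        F e d t x - 6 * ln (1 - t) - t < F e d (t - s) x - 6 * ln (1 - (t - s)) - (t - s)"
      using DERIV_neg_dec_left[of "\<lambda>s. F e d s x - 6 * ln (1 - s) - s"] by blast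
    define s where "s = min (h / 2) t"
    have s: "0 < s" "s < h" "t - s \<in> {0..T}"
      using h t0 tx(1) by (auto simp: s_def min_def)
    show False
      using h(2)[OF s(1,2)] max[OF s(3) M, of x] F[OF tx(2,3) x] by (simp add: u_def)
  qed
qed


section \<open>Non-collapsing\<close>

text \<open>The inverse metric is diagonal, so the squared norm is a sum of nonnegative terms. The
  single component R_0110 already contributes 1/(1 - t)^2, and a lower bound of this order is all
  that limits the admissible radii.\<close>

lemma rm_norm_flow_metric_ge:
  assumes t: "t < 1" and x: "x \<in> R3"
  shows "1 / (1 - t) \<le> rm_norm 3 (flow_metric t) x"
proof -
  define S where "S = riemann_lowered 3 (flow_metric t)"
  define J where "J is = (\<Prod>a<4. 1 / metric_diag t (is ! a) x)" for "is"
  have prod: "(\<Prod>a<4. inv_metric 3 (flow_metric t) (is ! a) (js ! a) x) = (if js = is then J is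
      else 0)"
    if m: "is \<in> multi_indices 3 4" "js \<in> multi_indices 3 4" for "is" js
  proof -
    have "(\<Prod>a<4. inv_metric 3 (flow_metric t) (is ! a) (js ! a) x) =
        (\<Prod>a<4. if is ! a = js ! a then 1 / metric_diag t (is ! a) x else 0)"
      using m by (intro prod.cong refl) (simp add: inv_flow_metric[OF t] multi_indices_nth)
    also have "\<dots> = (if js = is then J is else 0)"
    proof (cases "js = is")
      case False
      have "js = is" if "\<forall>a<4. is ! a = js ! a"
        using m that by (intro nth_equalityI) (auto simp: multi_indices_def)
      then obtain a where "a < 4" "is ! a \<noteq> js ! a" using False by blast
      then show ?thesis using False by (auto intro!: prod_zero)
    qed (simp add: J_def)
    finally show ?thesis .
  qed
  have J_nonneg: "0 \<le> J is" for "is"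
    unfolding J_def using metric_diag_pos[OF t] by (intro prod_nonneg) (simp add: less_imp_le)
  have "(\<Sum>is\<in>multi_indices 3 4. \<Sum>js\<in>multi_indices 3 4.
      (\<Prod>a<4. inv_metric 3 (flow_metric t) (is ! a) (js ! a) x) * S is x * S js x) =
    (\<Sum>is\<in>multi_indices 3 4. \<Sum>js\<in>multi_indices 3 4. if js = is then J is * S is x * S is x else 0)"
    by (intro sum.cong refl) (simp add: prod)
  also have "\<dots> = (\<Sum>is\<in>multi_indices 3 4. J is * S is x * S is x)"
    by (simp add: finite_multi_indices)
  finally have norm: "rm_norm 3 (flow_metric t) x = sqrt (\<Sum>is\<in>multi_indices 3 4. J is * S is x * S
      is x)"
    by (simp add: rm_norm_def tensor_norm_def S_def)
  have "J [0, 1, 1, 0] * S [0, 1, 1, 0] x * S [0, 1, 1, 0] x \<le> (\<Sum>is\<in>multi_indices 3 4. J is * S is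
      x * S is x)"
  proof (rule member_le_sum)
    show "[0, 1, 1, 0] \<in> multi_indices 3 4" by (simp add: multi_indices_def)
    show "0 \<le> J is * S is x * S is x" for "is"
      using J_nonneg[of "is"] by (simp add: mult.assoc)
  qed (rule finite_multi_indices)
  moreover have "J [0, 1, 1, 0] * S [0, 1, 1, 0] x * S [0, 1, 1, 0] x = (1 / (1 - t))\<^sup>2"
  proof -
    define \<tau> u where "\<tau> = 1 - t" and "u = sphere_density x"
    have nz: "\<tau> \<noteq> 0" "u \<noteq> 0" using t sphere_density_pos[of x] by (auto simp: \<tau>_def u_def)
    have "S [0, 1, 1, 0] x = \<tau> * u * u"
      by (simp add: S_def riemann_lowered_def sum_less_3 riemann_flow_metric[OF t x]
          flow_metric_def metric_diag_def \<tau>_def u_def)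
    moreover have "J [0, 1, 1, 0] = 1 / (\<tau> * u) ^ 4"
      by (simp add: J_def eval_nat_numeral metric_diag_def \<tau>_def u_def)
    ultimately show ?thesis
      unfolding \<tau>_def[symmetric] using nz by (simp add: field_simps eval_nat_numeral)
  qed
  ultimately have "(1 / (1 - t))\<^sup>2 \<le> (\<Sum>is\<in>multi_indices 3 4. J is * S is x * S is x)" by simp
  then show ?thesis
    unfolding norm using t by (intro real_le_rsqrt) 
qed

section \<open>Upper bounds for the distance by coordinate segments\<close>

definition push_vector :: "bool \<Rightarrow> bool \<Rightarrow> (nat \<Rightarrow> real) \<Rightarrow> (nat \<Rightarrow> real) \<Rightarrow> nat \<Rightarrow> real" where
  "push_vector a b x w i =
     (if i = 0 then jac_re a x * w 0 - jac_im a x * w 1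
      else if i = 1 then jac_im a x * w 0 + jac_re a x * w 1
      else if i = 2 then jac_circle b x * w 2 else 0)"

text \<open>\<open>curve_speed\<close> uses an unspecified chart, and
  \<open>piecewise_C1_curve\<close> asks for regularity in all of them, so a curve given in one
  chart must be differentiated in the others. \<open>push_vector\<close> is the differential of
  \<open>transition\<close> applied to the velocity.\<close>

lemma has_derivative_transition_curve:
  fixes c :: "real \<Rightarrow> nat \<Rightarrow> real"
  assumes c: "\<And>i. ((\<lambda>s. c s i) has_real_derivative w i) (at s)" and "c s \<in> overlap a b"
  shows "((\<lambda>s. transition a b (c s) i) has_real_derivative push_vector a b (c s) w i) (at s)"
proof -
  have nz: "a \<or> (c s 0)\<^sup>2 + (c s 1)\<^sup>2 \<noteq> 0" "b \<or> c s 2 \<noteq> 0"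
    using assms by (auto simp: overlap_def)
  have quot: "((\<lambda>s. f s / g s) has_real_derivative (f' * g s - f s * g') / (g s)\<^sup>2) (at s)"
    if "(f has_real_derivative f') (at s)" "(g has_real_derivative g') (at s)" "g s \<noteq> 0" for f g
        :: "real \<Rightarrow> real" and f' g'
    using DERIV_divide[OF that] by (simp add: power2_eq_square)
  have r: "((\<lambda>s. (c s 0)\<^sup>2 + (c s 1)\<^sup>2) has_real_derivative 2 * (c s 0 * w 0 + c s 1 * w 1)) (at s)"
    by (auto intro!: derivative_eq_intros c)
  show ?thesis
  proof (cases "i = 0 \<or> i = 1")
    case i: True
    show ?thesis
    proof (cases a)
      case True
      then show ?thesis
        using i c by (auto simp: transition_def push_vector_def jac_re_def jac_im_def)
    next
      case False
      define \<rho> where "\<rho> = (c s 0)\<^sup>2 + (c s 1)\<^sup>2"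
      have *: "(w 0 * \<rho> - c s 0 * (2 * (c s 0 * w 0 + c s 1 * w 1))) / \<rho>\<^sup>2 = push_vector a b (c s)
          w 0"
        "((- w 1) * \<rho> - (- c s 1) * (2 * (c s 0 * w 0 + c s 1 * w 1))) / \<rho>\<^sup>2 = push_vector a b (c
            s) w 1"
        using False unfolding push_vector_def jac_re_def jac_im_def \<rho>_def[symmetric]
        by (simp_all add: diff_divide_distrib[symmetric] add_divide_distrib[symmetric])
          (simp_all add: \<rho>_def power2_eq_square algebra_simps)
      have "\<rho> \<noteq> 0" using nz False by (simp add: \<rho>_def)
      then show ?thesis
        using i quot[OF c[of 0] r] quot[OF DERIV_minus[OF c[of 1]] r] False
        unfolding \<rho>_def[symmetric] * by (auto simp: transition_def)
    qed
  next
    case i: False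
    show ?thesis
    proof (cases b)
      case True
      then show ?thesis
        using i c by (auto simp: transition_def push_vector_def jac_circle_def)
    next
      case False
      have "((\<lambda>s. - 1 / c s 2) has_real_derivative jac_circle b (c s) * w 2) (at s)"
        using quot[OF DERIV_const[of "-1"] c[of 2]] nz False by (simp add: jac_circle_def)
      then show ?thesis
        using i False by (auto simp: transition_def push_vector_def)
    qed
  qed
qed

lemma push_vector_norm:
  assumes "x \<in> overlap a b"
  shows "(\<Sum>i<3. \<Sum>j<3. flow_metric t [i, j] (transition a b x) * push_vector a b x w i *
      push_vector a b x w j) =
    (1 - t) * sphere_density x * ((w 0)\<^sup>2 + (w 1)\<^sup>2) + (circle_density x)\<^sup>2 / (1 - t) * (w 2)\<^sup>2"
proof -
  have "(\<Sum>i<3. \<Sum>j<3. flow_metric t [i, j] (transition a b x) * push_vector a b x w i * push_vector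
      a b x w j) =
     (1 - t) * (((jac_re a x)\<^sup>2 + (jac_im a x)\<^sup>2) * sphere_density (transition a b x)) * ((w 0)\<^sup>2
         + (w 1)\<^sup>2)
     + (jac_circle b x * circle_density (transition a b x))\<^sup>2 / (1 - t) * (w 2)\<^sup>2"
    by (simp add: sum_less_3 flow_metric_def metric_diag_def push_vector_def power2_eq_square
        algebra_simps)
  then show ?thesis unfolding jac_density[OF assms] .
qed

definition segment :: "(nat \<Rightarrow> real) \<Rightarrow> (nat \<Rightarrow> real) \<Rightarrow> real \<Rightarrow> nat \<Rightarrow> real" where
  "segment x y s i = x i + s * (y i - x i)"

lemma segment_endpoints: "segment x y 0 = x" "segment x y 1 = y"
  by (simp_all add: segment_def fun_eq_iff)

lemma segment_in_R3: "x \<in> R3 \<Longrightarrow> y \<in> R3 \<Longrightarrow> segment x y s \<in> R3"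
  by (simp add: segment_def)

lemma has_derivative_segment: "((\<lambda>s. segment x y s i) has_real_derivative y i - x i) (at s)"
  unfolding segment_def by (auto intro!: derivative_eq_intros)

lemma continuous_on_segment: "continuous_on S (\<lambda>s. segment x y s i)"
  unfolding segment_def by (intro continuous_intros)

lemma stereo_segment_derivative:
  assumes s: "e \<in> sgns" "d \<in> sgns" "e' \<in> sgns" "d' \<in> sgns" and xy: "x \<in> R3" "y \<in> R3"
    and "unstereo e d (segment x y s) \<in> stereo_dom e' d'"
  shows "((\<lambda>s. stereo e' d' (unstereo e d (segment x y s)) i) has_vector_derivative
    push_vector (e = e') (d = d') (segment x y s) (\<lambda>i. y i - x i) i) (at s)"
proof -
  have "segment x y s \<in> overlap (e = e') (d = d')"
    using in_stereo_dom_iff[OF s segment_in_R3[OF xy]] assms(7) by simp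
  then show ?thesis
    unfolding has_real_derivative_iff_has_vector_derivative[symmetric]
      stereo_unstereo_eq_transition[OF s segment_in_R3[OF xy]]
    by (intro has_derivative_transition_curve has_derivative_segment)
qed

lemma piecewise_C1_curve_segment:
  assumes s: "e \<in> sgns" "d \<in> sgns" and xy: "x \<in> R3" "y \<in> R3"
  shows "piecewise_C1_curve 3 (top_of_set sphere_circle) stereo_atlas (\<lambda>s. unstereo e d (segment x
      y s))"
  unfolding piecewise_C1_curve_def
proof (intro conjI exI[of _ "{}"] ballI allI impI)
  have "continuous_on {0..1} (\<lambda>s. segment x y s)"
    by (intro continuous_on_coordinatewise_then_product continuous_on_segment)
  then have "continuous_on {0..1} (\<lambda>s. unstereo e d (segment x y s))"
    by (rule continuous_on_compose2[OF continuous_on_unstereo[of UNIV]]) simp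
  then show "continuous_map (top_of_set {0..1}) (top_of_set sphere_circle) (\<lambda>s. unstereo e d
      (segment x y s))"
    using unstereo_in_dom[OF s] by (auto simp: stereo_dom_def)
next
  fix c i assume "c \<in> stereo_atlas" "i < (3::nat)"
  then obtain e' d' where c: "e' \<in> sgns" "d' \<in> sgns" "c = stereo_chart e' d'" by (elim
      stereo_atlasE)
  define K where "K = {s \<in> {0..1} - {}. unstereo e d (segment x y s) \<in> fst c}"
  have K: "segment x y s \<in> overlap (e = e') (d = d')" if "s \<in> K" for s
    using in_stereo_dom_iff[OF s c(1,2) segment_in_R3[OF xy]] that c(3) by (simp add: K_def)
  have nz: "e = e' \<or> (segment x y s 0)\<^sup>2 + (segment x y s 1)\<^sup>2 \<noteq> 0" "d = d' \<or> segment x y s 2 \<noteq> 0"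
      if "s \<in> K" for s
    using K[OF that] by (simp_all add: overlap_def)
  have "continuous_on K (\<lambda>s. jac_re (e = e') (segment x y s))"
    by (cases "e = e'") (use nz in \<open>auto simp: jac_re_def intro!: continuous_intros
        continuous_on_segment\<close>)
  moreover have "continuous_on K (\<lambda>s. jac_im (e = e') (segment x y s))"
    by (cases "e = e'") (use nz in \<open>auto simp: jac_im_def intro!: continuous_intros
        continuous_on_segment\<close>)
  moreover have "continuous_on K (\<lambda>s. jac_circle (d = d') (segment x y s))"
    by (cases "d = d'") (use nz in \<open>auto simp: jac_circle_def intro!: continuous_intros
        continuous_on_segment\<close>)
  ultimately have D_cont: "continuous_on K (\<lambda>s. push_vector (e = e') (d = d') (segment x y s) (\<lambda>i.
      y i - x i) i)"
    by (cases "i = 0"; cases "i = 1"; cases "i = 2") (auto simp: push_vector_def intro!: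
        continuous_intros)
  have D: "((\<lambda>s. snd c (unstereo e d (segment x y s)) i) has_vector_derivative
      push_vector (e = e') (d = d') (segment x y s) (\<lambda>i. y i - x i) i) (at s)" if "s \<in> K" for s
    using stereo_segment_derivative[OF assms(1,2) c(1,2) xy, of s i] that c(3) by (simp add: K_def)
  show "(\<lambda>s. snd c (unstereo e d (segment x y s)) i) C1_differentiable_on
      {s \<in> {0..1} - {}. unstereo e d (segment x y s) \<in> fst c}"
    unfolding C1_differentiable_on_def K_def[symmetric]
    by (rule exI, rule conjI[OF ballI[OF D] D_cont])
qed simp

lemma curve_speed_segment:
  assumes s: "e \<in> sgns" "d \<in> sgns" and xy: "x \<in> R3" "y \<in> R3"
  shows "curve_speed 3 stereo_atlas (\<lambda>_. flow_metric t) (\<lambda>s. unstereo e d (segment x y s)) s =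
    sqrt ((1 - t) * sphere_density (segment x y s) * ((y 0 - x 0)\<^sup>2 + (y 1 - x 1)\<^sup>2)
      + (circle_density (segment x y s))\<^sup>2 / (1 - t) * (y 2 - x 2)\<^sup>2)"
proof -
  define \<gamma> where "\<gamma> = (\<lambda>s. unstereo e d (segment x y s))"
  \<comment> \<open>Nothing is known about the chosen chart except that it contains the point;
    \<open>push_vector_norm\<close> gives the same speed for every choice.\<close>
  define c where "c = (SOME c. c \<in> stereo_atlas \<and> \<gamma> s \<in> fst c)"
  have c: "c \<in> stereo_atlas \<and> \<gamma> s \<in> fst c"
    unfolding c_def
    by (rule someI[of _ "stereo_chart e d"])
      (simp add: stereo_chart_in_atlas[OF s] \<gamma>_def unstereo_in_dom[OF s])
  obtain e' d' where "e' \<in> sgns" "d' \<in> sgns" "c = stereo_chart e' d'"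
    by (rule stereo_atlasE[OF conjunct1[OF c]])
  with c have c: "e' \<in> sgns" "d' \<in> sgns" "c = stereo_chart e' d'" "\<gamma> s \<in> stereo_dom e' d'"
    by simp_all
  have ov: "segment x y s \<in> overlap (e = e') (d = d')"
    using in_stereo_dom_iff[OF s c(1,2) segment_in_R3[OF xy]] c(4) by (simp add: \<gamma>_def)
  have v: "vector_derivative (\<lambda>s. snd c (\<gamma> s) i) (at s) = push_vector (e = e') (d = d') (segment x
      y s) (\<lambda>i. y i - x i) i" for i
    using stereo_segment_derivative[OF s c(1,2) xy c(4)[unfolded \<gamma>_def], of i] c(3)
    by (simp add: \<gamma>_def vector_derivative_at)
  have p: "snd c (\<gamma> s) = transition (e = e') (d = d') (segment x y s)"
    using stereo_unstereo_eq_transition[OF s c(1,2) segment_in_R3[OF xy]] c(3) by (simp add: \<gamma>_def)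
  show ?thesis
    unfolding curve_speed_def \<gamma>_def[symmetric] c_def[symmetric] Let_def v p push_vector_norm[OF
        ov] ..
qed

lemma sphere_density_le: "sphere_density x \<le> 4"
  by (simp add: sphere_density_def divide_le_eq_1 divide_simps one_le_power)

lemma circle_density_le: "circle_density x \<le> 2"
  using one_plus_squares_pos(2)[of "x 2"] by (simp add: circle_density_def divide_le_eq)

text \<open>The densities are at most 4 and 2 everywhere, so the speed of the segment is bounded by
  its speed in a metric with constant coefficients.\<close>

lemma riemannian_dist_unstereo_le:
  assumes s: "e \<in> sgns" "d \<in> sgns" and xy: "x \<in> R3" "y \<in> R3" and t: "t < 1"
  shows "riemannian_dist 3 (top_of_set sphere_circle) stereo_atlas (\<lambda>_. flow_metric t) (unstereo e
      d x) (unstereo e d y)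
    \<le> ennreal (sqrt ((1 - t) * 4 * ((y 0 - x 0)\<^sup>2 + (y 1 - x 1)\<^sup>2) + 4 / (1 - t) * (y 2 - x
        2)\<^sup>2))" (is "_ \<le> ennreal ?L")
proof -
  define \<gamma> where "\<gamma> = (\<lambda>s. unstereo e d (segment x y s))"
  have speed: "curve_speed 3 stereo_atlas (\<lambda>_. flow_metric t) \<gamma> s \<le> ?L" for s
  proof -
    have "(circle_density (segment x y s))\<^sup>2 \<le> 2\<^sup>2"
      using circle_density_le circle_density_pos[of "segment x y s"] by (intro power_mono)
          (simp_all add: less_imp_le)
    then have "(circle_density (segment x y s))\<^sup>2 \<le> 4" by simp
    then show ?thesis
      unfolding \<gamma>_def curve_speed_segment[OF s xy] using t sphere_density_le[of "segment x y s"]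
      by (intro real_sqrt_le_mono add_mono mult_right_mono mult_left_mono divide_right_mono)
          simp_all
  qed
  have "riemannian_dist 3 (top_of_set sphere_circle) stereo_atlas (\<lambda>_. flow_metric t) (unstereo e
      d x) (unstereo e d y)
      \<le> curve_length 3 stereo_atlas (\<lambda>_. flow_metric t) \<gamma>"
    unfolding riemannian_dist_def \<gamma>_def
    by (rule INF_lower) (use piecewise_C1_curve_segment[OF s xy] in \<open>simp add: segment_endpoints\<close>)
  also have "\<dots> \<le> (\<integral>\<^sup>+s. ennreal ?L * indicator {0..1} s \<partial>(lborel :: real measure))"
    unfolding curve_length_def by (intro nn_integral_mono mult_right_mono ennreal_leI speed) simp
  also have "\<dots> = ennreal ?L"
    by (simp add: nn_integral_cmult_indicator)
  finally show ?thesis .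
qed

section \<open>Lower bounds for the volume and the non-collapsing constant\<close>

lemma det_flow_metric:
  assumes "t < 1"
  shows "sqrt (Determinant.det (metric_mat 3 (flow_metric t) x)) = sqrt (1 - t) * sphere_density x
      * circle_density x"
proof -
  have "Determinant.det (metric_mat 3 (flow_metric t) x) = prod_list (diag_mat (metric_mat 3
      (flow_metric t) x))"
    by (rule det_upper_triangular[of _ 3]) (auto simp: metric_mat_def upper_triangular_def
        flow_metric_def)
  also have "\<dots> = metric_diag t 0 x * metric_diag t 1 x * metric_diag t 2 x"
    by (simp add: diag_mat_def metric_mat_def flow_metric_def eval_nat_numeral)
  also have "\<dots> = (1 - t) * (sphere_density x)\<^sup>2 * (circle_density x)\<^sup>2"
    using assms by (simp add: metric_diag_def power2_eq_square)
  finally show ?thesis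
    using sphere_density_pos[of x] circle_density_pos[of x] by (simp add: real_sqrt_mult)
qed

definition coord_box :: "(nat \<Rightarrow> real) \<Rightarrow> (nat \<Rightarrow> real) \<Rightarrow> (nat \<Rightarrow> real) set" where
  "coord_box x \<rho> = {y \<in> R3. \<forall>i<3. \<bar>y i - x i\<bar> < \<rho> i}"

lemma openin_preimage_box:
  assumes s: "e \<in> sgns" "d \<in> sgns"
  shows "openin (top_of_set sphere_circle) {q \<in> stereo_dom e d. stereo e d q \<in> coord_box x \<rho>}"
proof -
  have "open {y::nat \<Rightarrow> real. \<bar>y 0 - x 0\<bar> < \<rho> 0 \<and> \<bar>y 1 - x 1\<bar> < \<rho> 1 \<and> \<bar>y 2 - x 2\<bar> < \<rho> 2}"
    by (intro open_Collect_conj open_Collect_less continuous_intros)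
  then have 1: "openin (top_of_set (stereo_dom e d)) (stereo_dom e d \<inter> stereo e d -`
      {y. \<bar>y 0 - x 0\<bar> < \<rho> 0 \<and> \<bar>y 1 - x 1\<bar> < \<rho> 1 \<and> \<bar>y 2 - x 2\<bar> < \<rho> 2})"
    by (rule continuous_openin_preimage_gen[OF continuous_on_stereo[OF s]])
  have 2: "stereo_dom e d \<inter> stereo e d -` {y. \<bar>y 0 - x 0\<bar> < \<rho> 0 \<and> \<bar>y 1 - x 1\<bar> < \<rho> 1 \<and> \<bar>y 2 - x 2\<bar>
      < \<rho> 2}
     = {q \<in> stereo_dom e d. stereo e d q \<in> coord_box x \<rho>}"
  proof -
    have "(\<forall>i<3. P i) \<longleftrightarrow> P 0 \<and> P 1 \<and> P 2" for P :: "nat \<Rightarrow> bool"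
      by (auto dest: less_3_cases)
    then show ?thesis using stereo_in_R3 by (auto simp: coord_box_def)
  qed
  have "openin (top_of_set sphere_circle) (stereo_dom e d)"
    using is_chart_stereo_chart[OF s] by (simp add: is_chart_def)
  from openin_trans[OF 1 this] show ?thesis unfolding 2 .
qed

text \<open>The box has coordinate volume 8 \<rho>_0 \<rho>_1 \<rho>_2, and near the unit cube the
  density is at least sqrt(1 - t)/8; the factors 8 cancel.\<close>

lemma chart_volume_box_ge:
  assumes s: "e \<in> sgns" "d \<in> sgns" and t: "t < 1" and x: "x \<in> unit_cube"
    and \<rho>: "\<And>i. 0 \<le> \<rho> i" "\<And>i. \<rho> i \<le> 1 / 8"
  shows "ennreal (sqrt (1 - t) * \<rho> 0 * \<rho> 1 * \<rho> 2) \<le>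
     chart_volume 3 (\<lambda>_. flow_metric t) (stereo_chart e d) {q \<in> stereo_dom e d. stereo e d q \<in>
         coord_box x \<rho>}"
proof -
  interpret product_sigma_finite "\<lambda>_::nat. lborel :: real measure"
    by standard
  have im: "stereo e d ` {q \<in> stereo_dom e d. stereo e d q \<in> coord_box x \<rho>} = coord_box x \<rho>"
  proof (intro equalityI subsetI)
    fix y assume y: "y \<in> coord_box x \<rho>"
    then have "stereo e d (unstereo e d y) = y"
      by (intro stereo_unstereo[OF s]) (simp add: coord_box_def)
    then show "y \<in> stereo e d ` {q \<in> stereo_dom e d. stereo e d q \<in> coord_box x \<rho>}"
      using y unstereo_in_dom[OF s] by (intro image_eqI[of _ _ "unstereo e d y"]) auto
  qed auto
  \<comment> \<open>On the box |y_i| \<le> 9/8, hence y_i^2 \<le> 3/2, and the sums 1 + |z|^2 and 1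
    + u^2 are at most 4. The two densities are then at least 4/16 and 2/4, with product 1/8.\<close>
  define c where "c = sqrt (1 - t) / 8"
  have dens: "c \<le> sqrt (1 - t) * sphere_density y * circle_density y" if "y \<in> coord_box x \<rho>" for y
  proof -
    have sq: "(y i)\<^sup>2 \<le> 3 / 2" if "i < 3" for i
    proof -
      have "\<bar>x i\<bar> \<le> 1" "\<bar>y i - x i\<bar> < \<rho> i" "\<rho> i \<le> 1 / 8"
        using that x \<open>y \<in> coord_box x \<rho>\<close> \<rho> by (auto simp: unit_cube_def coord_box_def)
      then have "\<bar>y i\<bar> \<le> 9 / 8" by linarith
      then have "\<bar>y i\<bar>\<^sup>2 \<le> (9 / 8)\<^sup>2" by (intro power_mono) auto
      then show ?thesis by (simp add: power2_eq_square)
    qed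
    have "(y 0)\<^sup>2 \<le> 3 / 2" "(y 1)\<^sup>2 \<le> 3 / 2" "(y 2)\<^sup>2 \<le> 3 / 2"
      by (rule sq, simp)+
    then have "1 + (y 0)\<^sup>2 + (y 1)\<^sup>2 \<le> 4" "1 + (y 2)\<^sup>2 \<le> 4"
      by linarith+
    moreover from this have "(1 + (y 0)\<^sup>2 + (y 1)\<^sup>2)\<^sup>2 \<le> 4\<^sup>2"
      by (intro power_mono) auto
    ultimately have "1 / 4 \<le> sphere_density y" "1 / 2 \<le> circle_density y"
      using one_plus_squares_pos[of "y 2"]
      by (simp_all add: sphere_density_def circle_density_def field_simps)
    then have "1 / 4 * (1 / 2) \<le> sphere_density y * circle_density y"
      by (intro mult_mono) auto
    then show ?thesis
      using t mult_left_mono[of "1 / 8" "sphere_density y * circle_density y" "sqrt (1 - t)"]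
      by (simp add: c_def mult.assoc)
  qed
  \<comment> \<open>The same box in the space of the product measure, whose points are undefined
    rather than 0 at the indices from 3 on.\<close>
  define B where "B = PiE {..<3} (\<lambda>i. {x i - \<rho> i<..<x i + \<rho> i})"
  have "ennreal (sqrt (1 - t) * \<rho> 0 * \<rho> 1 * \<rho> 2) = ennreal c * (\<Prod>i<3. ennreal (2 * \<rho> i))"
  proof -
    have "(\<Prod>i<(3::nat). f i) = f 0 * f 1 * f 2" for f :: "nat \<Rightarrow> ennreal"
      by (simp add: eval_nat_numeral mult.assoc)
    then show ?thesis
      using \<rho>(1) t by (simp add: c_def ennreal_mult[symmetric] del: ennreal_mult)
  qed
  also have "\<dots> = ennreal c * emeasure (\<Pi>\<^sub>M i\<in>{..<3}. lborel) B"
    unfolding B_def using \<rho>(1) by (subst emeasure_PiM) (auto intro!: arg_cong[of _ _ "(*) (ennreal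
        c)"] prod.cong)
  also have "\<dots> = (\<integral>\<^sup>+y. ennreal c * indicator B y \<partial>(\<Pi>\<^sub>M i\<in>{..<3}. lborel))"
    by (subst nn_integral_cmult_indicator) (auto simp: B_def intro!: sets_PiM_I_finite)
  also have "\<dots> \<le> chart_volume 3 (\<lambda>_. flow_metric t) (stereo_chart e d) {q \<in> stereo_dom e d. stereo
      e d q \<in> coord_box x \<rho>}"
    unfolding chart_volume_def stereo_chart_simps im Let_def
  proof (rule nn_integral_mono)
    fix y :: "nat \<Rightarrow> real"
    let ?y = "\<lambda>i. if i < 3 then y i else 0"
    show "ennreal c * indicator B y \<le>
        ennreal (sqrt (Determinant.det (metric_mat 3 (flow_metric t) ?y))) * indicator (coord_box
            x \<rho>) ?y"
    proof (cases "y \<in> B")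
      case True
      then have "?y \<in> coord_box x \<rho>"
        by (auto simp: B_def coord_box_def PiE_def Pi_def abs_less_iff)
      then show ?thesis
        using True dens by (simp add: det_flow_metric[OF t] ennreal_leI)
    qed simp
  qed
  finally show ?thesis .
qed

text \<open>The single pair of \<open>E\<close> and \<open>c\<close> is one of the families in the
  supremum.\<close>

lemma riemannian_volume_ge:
  assumes "c \<in> A" "openin X E" "E \<subseteq> fst c" "E \<subseteq> B"
  shows "chart_volume n g c E \<le> riemannian_volume X n A g B"
proof -
  have "{(E, c)} \<in> {P. finite P \<and> disjoint_family_on fst P \<and>
               (\<forall>(E, c)\<in>P. c \<in> A \<and> E \<in> sigma_sets (topspace X) {W. openin X W} \<and>
                            E \<subseteq> fst c \<and> E \<subseteq> B)}"
    using assms by (auto simp: disjoint_family_on_def intro: sigma_sets.Basic)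
  from SUP_upper[OF this, of "\<lambda>P. \<Sum>(E, c)\<in>P. chart_volume n g c E"] show ?thesis
    by (simp add: riemannian_volume_def)
qed

lemma non_collapsing_flow_metric:
  "non_collapsing 3 (top_of_set sphere_circle) stereo_atlas 1 (\<lambda>t _. flow_metric t)"
  unfolding non_collapsing_def
\<comment> \<open>The constant is 8^(-3): the half-sides chosen below have product r^3/(512
  \<sigma>), and the density contributes the factor \<sigma> = sqrt(1 - t).\<close>
proof (intro exI[of _ "1 / 512"] conjI ballI allI impI)
  fix p t r
  assume pM: "p \<in> topspace (top_of_set sphere_circle)" and t: "t \<in> {0..<1::real}" and r: "0 < r \<and>
      r \<le> sqrt 1"
    and curv: "\<forall>q\<in>riemannian_ball 3 (top_of_set sphere_circle) stereo_atlas (\<lambda>_. flow_metric t) p r.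
      \<forall>c\<in>stereo_atlas. q \<in> fst c \<longrightarrow> rm_norm 3 (flow_metric t) (snd c q) \<le> 1 / r\<^sup>2"
  have "p \<in> sphere_circle" using pM by simp
  then obtain e d where s: "e \<in> sgns" "d \<in> sgns" and p: "p \<in> stereo_dom e d"
    and le: "(stereo e d p 0)\<^sup>2 + (stereo e d p 1)\<^sup>2 \<le> 1" "(stereo e d p 2)\<^sup>2 \<le> 1"
    by (rule stereo_centre)
  define x where "x = stereo e d p"
  have x: "x \<in> R3" "p = unstereo e d x"
    using stereo_in_R3 unstereo_stereo[OF p s] by (simp_all add: x_def)
  have t1: "t < 1" "0 < 1 - t" "1 - t \<le> 1" using t by auto
  have ball: "unstereo e d y \<in> riemannian_ball 3 (top_of_set sphere_circle) stereo_atlas (\<lambda>_.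
      flow_metric t) p r"
    if "y \<in> R3" "(1 - t) * 4 * ((y 0 - x 0)\<^sup>2 + (y 1 - x 1)\<^sup>2) + 4 / (1 - t) * (y 2 - x 2)\<^sup>2 <
        r\<^sup>2" for y
  proof -
    have "sqrt ((1 - t) * 4 * ((y 0 - x 0)\<^sup>2 + (y 1 - x 1)\<^sup>2) + 4 / (1 - t) * (y 2 - x 2)\<^sup>2) < r"
      using that(2) r real_less_lsqrt by simp
    then have "riemannian_dist 3 (top_of_set sphere_circle) stereo_atlas (\<lambda>_. flow_metric t) p
        (unstereo e d y) < ennreal r"
      unfolding x(2) using riemannian_dist_unstereo_le[OF s x(1) that(1) t1(1)] r
      by (elim le_less_trans) (simp add: ennreal_lessI)
    then show ?thesis
      using unstereo_in_dom[OF s] by (simp add: riemannian_ball_def stereo_dom_def)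
  qed
  \<comment> \<open>The curvature hypothesis is used only at the centre of the ball, where it forces
    r^2 \<le> 1 - t.\<close>
  have "p \<in> riemannian_ball 3 (top_of_set sphere_circle) stereo_atlas (\<lambda>_. flow_metric t) p r"
    using ball[OF x(1)] r x(2) by simp
  then have "rm_norm 3 (flow_metric t) x \<le> 1 / r\<^sup>2"
    using curv stereo_chart_in_atlas[OF s] p unfolding x_def by (metis stereo_chart_simps)
  then have "1 / (1 - t) \<le> 1 / r\<^sup>2"
    using rm_norm_flow_metric_ge[OF t1(1) x(1)] by linarith
  then have r2: "r\<^sup>2 \<le> 1 - t"
    using t1 r by (simp add: field_simps)
  define \<sigma> where "\<sigma> = sqrt (1 - t)"
  have \<sigma>: "0 < \<sigma>" "\<sigma> \<le> 1" "\<sigma>\<^sup>2 = 1 - t" "r \<le> \<sigma>"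
    using t1 r2 real_le_rsqrt by (simp_all add: \<sigma>_def)
  \<comment> \<open>The half-sides undo the scaling of lengths by \<sigma> on the sphere and by
    1/\<sigma> on the circle. The divisor 8 bounds squared distances by (1/8 + 1/16) r^2 < r^2. It
    also keeps the half-sides at most 1/8, on the sphere by r \<le> \<sigma> and on the circle by r
    \<sigma> \<le> 1.\<close>
  define \<rho> where "\<rho> i = (if i < 2 then r / (8 * \<sigma>) else r * \<sigma> / 8)" for i :: nat
  have \<rho>: "0 \<le> \<rho> i" "\<rho> i \<le> 1 / 8" for i
  proof -
    have "r * \<sigma> \<le> 1 * 1" using r \<sigma> by (intro mult_mono) auto
    then show "\<rho> i \<le> 1 / 8" using \<sigma> by (simp add: \<rho>_def field_simps)
  qed (use r \<sigma> in \<open>simp add: \<rho>_def\<close>)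
  have cube: "x \<in> unit_cube"
  proof -
    have "u\<^sup>2 \<le> 1 \<and> v\<^sup>2 \<le> 1" if "u\<^sup>2 + v\<^sup>2 \<le> 1" for u v :: real
      using that zero_le_power2[of u] zero_le_power2[of v] by linarith
    then have "(x i)\<^sup>2 \<le> 1" if "i < 3" for i
      using le that less_3_cases[OF that] unfolding x_def by (metis One_nat_def)
    then show ?thesis using x(1) by (simp add: unit_cube_def abs_square_le_1)
  qed
  define E where "E = {q \<in> stereo_dom e d. stereo e d q \<in> coord_box x \<rho>}"
  have "E \<subseteq> riemannian_ball 3 (top_of_set sphere_circle) stereo_atlas (\<lambda>_. flow_metric t) p r"
  proof
    fix q assume q: "q \<in> E"
    define y where "y = stereo e d q"
    have y: "y \<in> R3" "q = unstereo e d y"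
      using q stereo_in_R3 unstereo_stereo[OF _ s, of q] by (simp_all add: y_def E_def)
    have "(y i - x i)\<^sup>2 \<le> (\<rho> i)\<^sup>2" if "i < 3" for i
    proof -
      have "\<bar>y i - x i\<bar> \<le> \<rho> i" using q that by (auto simp: E_def coord_box_def y_def less_imp_le)
      then show ?thesis using abs_le_square_iff[of "y i - x i" "\<rho> i"] \<rho>(1)[of i] by simp
    qed
    from this[of 0] this[of 1] this[of 2]
    have "(y 0 - x 0)\<^sup>2 + (y 1 - x 1)\<^sup>2 \<le> 2 * (r / (8 * \<sigma>))\<^sup>2" "(y 2 - x 2)\<^sup>2 \<le> (r * \<sigma> / 8)\<^sup>2"
      by (simp_all add: \<rho>_def)
    then have "(1 - t) * 4 * ((y 0 - x 0)\<^sup>2 + (y 1 - x 1)\<^sup>2) + 4 / (1 - t) * (y 2 - x 2)\<^sup>2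
        \<le> (1 - t) * 4 * (2 * (r / (8 * \<sigma>))\<^sup>2) + 4 / (1 - t) * (r * \<sigma> / 8)\<^sup>2"
      using t1 by (intro add_mono mult_left_mono) auto
    also have "\<dots> = 3 / 16 * r\<^sup>2"
      unfolding \<sigma>(3)[symmetric] using \<sigma>(1) by (simp add: field_simps power2_eq_square)
    also have "\<dots> < r\<^sup>2" using r by simp
    finally show "q \<in> riemannian_ball 3 (top_of_set sphere_circle) stereo_atlas (\<lambda>_. flow_metric
        t) p r"
      using ball[OF y(1)] y(2) by simp
  qed
  then have "chart_volume 3 (\<lambda>_. flow_metric t) (stereo_chart e d) E \<le>
      riemannian_volume (top_of_set sphere_circle) 3 stereo_atlas (\<lambda>_. flow_metric t)
        (riemannian_ball 3 (top_of_set sphere_circle) stereo_atlas (\<lambda>_. flow_metric t) p r)"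
    using openin_preimage_box[OF s, of x \<rho>]
    by (intro riemannian_volume_ge stereo_chart_in_atlas[OF s]) (auto simp: E_def)
  moreover have "sqrt (1 - t) * \<rho> 0 * \<rho> 1 * \<rho> 2 = 1 / 512 * r ^ 3"
    unfolding \<sigma>_def[symmetric] using \<sigma>(1) by (simp add: \<rho>_def field_simps eval_nat_numeral)
  ultimately show "ennreal (1 / 512 * r ^ 3) \<le> riemannian_volume (top_of_set sphere_circle) 3
      stereo_atlas (\<lambda>_. flow_metric t)
        (riemannian_ball 3 (top_of_set sphere_circle) stereo_atlas (\<lambda>_. flow_metric t) p r)"
    using order_trans[OF chart_volume_box_ge[where \<rho> = \<rho>, OF s t1(1) cube \<rho>, folded E_def]] by metis
qed simp

theorem corollary4p6:
  shows "\<exists>(n::nat) (X :: (nat \<Rightarrow> real) topology) (A :: (nat \<Rightarrow> real) chart set) (T::real) g H.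
     closed_manifold n X A \<and> 0 < T \<and>
     generalized_ricci_flow n A T g H \<and>
     non_collapsing n X A T g \<and>
     \<not> (\<exists>\<psi>. torsion_bounding n X A T g H \<psi>)"
proof (intro exI conjI)
  show "closed_manifold 3 (top_of_set sphere_circle) stereo_atlas"
    by (rule closed_manifold_sphere_circle)
  show "0 < (1::real)" by simp
  show "generalized_ricci_flow 3 stereo_atlas 1 (\<lambda>t _. flow_metric t) (\<lambda>t _. torsion_form)"
    by (rule generalized_ricci_flow_flow_metric)
  show "non_collapsing 3 (top_of_set sphere_circle) stereo_atlas 1 (\<lambda>t _. flow_metric t)"
    by (rule non_collapsing_flow_metric)
  show "\<not> (\<exists>\<psi>. torsion_bounding 3 (top_of_set sphere_circle) stereo_atlas 1
      (\<lambda>t _. flow_metric t) (\<lambda>t _. torsion_form) \<psi>)"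
    using no_torsion_bounding_function by blast
qed

end
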